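(* Let $T>0$, $d\ge 1$, $x_0\in\mathbb{R}^d$, and let $F:[0,T]\times\mathbb{R}^d\rightrightarrows\mathbb{R}^d$ be a set-valued map such that: (H1) $F(t,x)$ is nonempty, closed and convex for every $(t,x)$; (H2) for every open $U\subset\mathbb{R}^d$ the set $\{(t,x)\in[0,T]\times\mathbb{R}^d: F(t,x)\cap U\neq\varnothing\}$ belongs to the product $\sigma$-field $\mathscr{L}([0,T])\otimes\mathcal{B}(\mathbb{R}^d)$, and $x\mapsto F(t,x)$ is upper semicontinuous for a.e. $t\in[0,T]$; (H3) there exists $m\in L^2(0,T)$, $m\ge 0$, such that $\sup_{v\in F(t,x)}|v|\le m(t)(1+|x|)$ for a.e. $t\in[0,T]$ and every $x\in\mathbb{R}^d$. Let $\mathcal{A}:=\{x\in W^{1,2}(0,T;\mathbb{R}^d): x(0)=x_0\}$, for $x\in\mathcal{A}$ let $$\mathcal{J}(x):=\int_0^T \operatorname{dist}^2\bigl(\dot x(t),F(t,x(t))\bigr)\,dt,$$ and let $\mathcal{S}(x_0)$ be the set of absolutely continuous $x:[0,T]\to\mathbb{R}^d$ with $x(0)=x_0$ and $\dot x(t)\in F(t,x(t))$ for a.e. $t\in[0,T]$. Then: (a) (Exactness) For every $x\in\mathcal{A}$, $\mathcal{J}(x)=0$ if and only if $x\in\mathcal{S}(x_0)$. (b) (Asymptotic consistency) If $\{x_n\}_{n\in\mathbb{N}}\subset\mathcal{A}$ satisfies $\mathcal{J}(x_n)\to 0$, then there exist a subsequence (still denoted $\{x_n\}$) and $x^*\in\mathcal{A}$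 such that $x_n\to x^*$ uniformly on $[0,T]$, $\dot x_n\rightharpoonup\dot x^*$ weakly in $L^2(0,T;\mathbb{R}^d)$, and $x^*\in\mathcal{S}(x_0)$.
   Context: $|\cdot|$ is the Euclidean norm and $\operatorname{dist}(v,C)=\inf_{w\in C}|v-w|$. $\mathscr{L}([0,T])$ is the Lebesgue $\sigma$-field of $[0,T]$ and $\mathcal{B}(\mathbb{R}^d)$ the Borel $\sigma$-field. A set-valued map $G:X\rightrightarrows Y$ between topological spaces is upper semicontinuous at $x$ if for every open $U\supset G(x)$ there is a neighborhood $V$ of $x$ with $G(x')\subset U$ for all $x'\in V$; it is upper semicontinuous if this holds at every $x$. Elements of $W^{1,2}(0,T;\mathbb{R}^d)$ are identified with their absolutely continuous representatives on $[0,T]$. *)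

theory Defs
  imports "HOL-Analysis.Analysis"
begin

definition usc_at :: "('a::topological_space \<Rightarrow> 'b::topological_space set) \<Rightarrow> 'a \<Rightarrow> bool" where
  "usc_at G x \<longleftrightarrow>
     (\<forall>U. open U \<and> G x \<subseteq> U \<longrightarrow> (\<exists>V. open V \<and> x \<in> V \<and> (\<forall>x'\<in>V. G x' \<subseteq> U)))"

definition usc :: "('a::topological_space \<Rightarrow> 'b::topological_space set) \<Rightarrow> bool" where
  "usc G \<longleftrightarrow> (\<forall>x. usc_at G x)"

text \<open>The library constant \<open>absolutely_continuous\<close> is about measures; this one is about
  functions on a real interval \<open>I\<close>.\<close>

definition abs_continuous_on :: "real set \<Rightarrow> (real \<Rightarrow> 'a::real_normed_vector) \<Rightarrow> bool" where
  "abs_continuous_on I x \<longleftrightarrow>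
     (\<forall>\<epsilon>>0. \<exists>\<delta>>0. \<forall>(n::nat) a b.
        (\<forall>i<n. a i \<in> I \<and> b i \<in> I \<and> a i \<le> b i) \<and>
        disjoint_family_on (\<lambda>i. {a i<..<b i}) {..<n} \<and>
        (\<Sum>i<n. b i - a i) < \<delta>
        \<longrightarrow> (\<Sum>i<n. norm (x (b i) - x (a i))) < \<epsilon>)"

text \<open>Functions on \<open>[0,T]\<close> are total functions on the reals of which only the values on
  \<open>{0..T}\<close> matter; elements of \<open>L\<^sup>2\<close> are represented by functions, without passing to classes
  modulo null sets.\<close>

definition L2 :: "real \<Rightarrow> (real \<Rightarrow> 'a::euclidean_space) \<Rightarrow> bool" where
  "L2 T f \<longleftrightarrow> f \<in> borel_measurable (lebesgue_on {0..T}) \<and>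
     integrable (lebesgue_on {0..T}) (\<lambda>t. (norm (f t))\<^sup>2)"

definition weakly_tendsto_L2 ::
  "real \<Rightarrow> (nat \<Rightarrow> real \<Rightarrow> 'a::euclidean_space) \<Rightarrow> (real \<Rightarrow> 'a) \<Rightarrow> bool" where
  "weakly_tendsto_L2 T u v \<longleftrightarrow> (\<forall>n. L2 T (u n)) \<and> L2 T v \<and>
     (\<forall>h. L2 T h \<longrightarrow>
        (\<lambda>n. LINT t|lebesgue_on {0..T}. u n t \<bullet> h t)
          \<longlonglongrightarrow> (LINT t|lebesgue_on {0..T}. v t \<bullet> h t))"

text \<open>Weak derivatives on \<open>(0,T)\<close>, tested against \<open>C\<^sup>1\<close> functions with compact support in
  \<open>(0,T)\<close>, as in Brezis.\<close>

definition test_function :: "real \<Rightarrow> (real \<Rightarrow> real) \<Rightarrow> bool" where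
  "test_function T \<phi> \<longleftrightarrow>
     (\<forall>t. \<phi> differentiable (at t)) \<and> continuous_on UNIV (deriv \<phi>) \<and>
     compact (closure {t. \<phi> t \<noteq> 0}) \<and> closure {t. \<phi> t \<noteq> 0} \<subseteq> {0<..<T}"

definition weak_derivative ::
  "real \<Rightarrow> (real \<Rightarrow> 'a::euclidean_space) \<Rightarrow> (real \<Rightarrow> 'a) \<Rightarrow> bool" where
  "weak_derivative T x g \<longleftrightarrow>
     (\<forall>\<phi>. test_function T \<phi> \<longrightarrow>
        (LINT t|lebesgue_on {0..T}. deriv \<phi> t *\<^sub>R x t)
          = - (LINT t|lebesgue_on {0..T}. \<phi> t *\<^sub>R g t))"

text \<open>\<open>W\<^sup>1\<^sup>,\<^sup>2(0,T)\<close>, each element being given by its absolutely continuous representative on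
  \<open>[0,T]\<close>.\<close>

definition W12 :: "real \<Rightarrow> (real \<Rightarrow> 'a::euclidean_space) set" where
  "W12 T = {x. abs_continuous_on {0..T} x \<and> L2 T x \<and> (\<exists>g. L2 T g \<and> weak_derivative T x g)}"

text \<open>The a.e. classical derivative of an absolutely continuous function; at a point of
  non-differentiability the value is arbitrary.\<close>

abbreviation dot :: "real \<Rightarrow> (real \<Rightarrow> 'a::euclidean_space) \<Rightarrow> real \<Rightarrow> 'a" where
  "dot T x t \<equiv> vector_derivative x (at t within {0..T})"

definition admissible :: "real \<Rightarrow> 'a::euclidean_space \<Rightarrow> (real \<Rightarrow> 'a) set" where
  "admissible T x0 = {x \<in> W12 T. x 0 = x0}"

text \<open>The integral is taken in \<open>[0,\<infinity>]\<close>, so that no integrability is presupposed;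
  \<open>infdist\<close> is the distance to a set (here nonempty).\<close>

definition residual ::
  "real \<Rightarrow> (real \<Rightarrow> 'a \<Rightarrow> 'a set) \<Rightarrow> (real \<Rightarrow> 'a::euclidean_space) \<Rightarrow> ennreal" where
  "residual T F x =
     (\<integral>\<^sup>+ t. ennreal ((infdist (dot T x t) (F t (x t)))\<^sup>2) \<partial>lebesgue_on {0..T})"

definition solutions ::
  "real \<Rightarrow> (real \<Rightarrow> 'a \<Rightarrow> 'a set) \<Rightarrow> 'a::euclidean_space \<Rightarrow> (real \<Rightarrow> 'a) set" where
  "solutions T F x0 = {x. abs_continuous_on {0..T} x \<and> x 0 = x0 \<and>
     (AE t in lebesgue_on {0..T}.
        \<exists>v\<in>F t (x t). (x has_vector_derivative v) (at t within {0..T}))}"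

end

theory Submission
  imports Defs "HOL-Complex_Analysis.Great_Picard"
begin

text \<open>Elements of \<open>W\<^sup>1\<^sup>,\<^sup>2\<close> are indefinite integrals of their weak derivative, and by Lebesgue's
  differentiation theorem this is the classical derivative almost everywhere; so the residual
  vanishes iff \<open>x\<close> is a solution. For a sequence with vanishing residuals, the linear growth of
  \<open>F\<close> bounds \<open>x\<^sub>n\<close> uniformly and its derivatives in \<open>L\<^sup>2\<close>, and Arzela-Ascoli gives a uniform limit
  along a subsequence. Midpoint-convex combinations of the tails of the derivatives, chosen to
  nearly minimise the \<open>L\<^sup>2\<close> norm, converge almost everywhere, necessarily to the derivative of the
  uniform limit. Since \<open>F(t,\<cdot>)\<close> is upper semicontinuous with closed convex values, that derivative
  lies in \<open>F(t,x\<^sup>*(t))\<close>.\<close>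

section \<open>Lebesgue differentiation\<close>

text \<open>Two obstacles shape the proof. Membership in \<open>W12\<close> provides some weak
  derivative, while the residual and the solutions use the classical one; the two are identified
  before anything else, and the classical one gets its measurability from a.e. equality with the
  weak one. Secondly, weak convergence in L2 says nothing at a single t, whereas the inclusion is a
  condition at each t. Convex combinations of tails restore a.e. convergence, and averages of two
  functions suffice, since only these enter the parallelogram law. The sets F(t, x_n(t)) vary with
  n, so the distances to them are not averaged: the residuals are first made to decay like 2^-n,
  hence are summable, and the distance of the n-th velocity to its own set tends to 0 at almost
  every t. Upper semicontinuity then replaces these sets by a convex neighbourhood of one fixed set,
  in which averaging is harmless. The same averaging, applied to a subsequence chosen by
  contradiction, gives weak convergence of the velocities themselves, which the proof uses to place
  the uniform limit in \<open>W12\<close>.\<close>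

lemma indefinite_integral_diff:
  fixes f :: "real \<Rightarrow> 'a::euclidean_space"
  assumes "f integrable_on {a..b}" "a \<le> s" "s \<le> t" "t \<le> b"
  shows "integral {a..t} f - integral {a..s} f = integral {s..t} f"
proof -
  have "f integrable_on {a..t}"
    using assms by (auto intro: integrable_on_subinterval)
  then show ?thesis
    using Henstock_Kurzweil_Integration.integral_combine[of a s t f] assms by (simp add: algebra_simps)
qed

text \<open>Henstock's lemma bounds the sum of the errors over disjoint intervals; a Vitali covering by
  intervals on which the difference quotient is off by \<open>1/(n+1)\<close> then has small total length.\<close>

lemma indefinite_integral_has_vector_derivative_ae:
  fixes f :: "real \<Rightarrow> 'a::euclidean_space"
  assumes f: "f integrable_on {a..b}"
  shows "negligible {x \<in> {a..b}.
    \<not> ((\<lambda>t. integral {a..t} f) has_vector_derivative f x) (at x within {a..b})}"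
proof -
  define G where "G t = integral {a..t} f" for t
  define bad where "bad n x y \<longleftrightarrow>
    norm (G y - G x - (y - x) *\<^sub>R f x) > \<bar>y - x\<bar> / real (Suc n)" for n x y
  \<comment> \<open>Differentiability fails here with a fixed tolerance at arbitrarily small scales;
    countably many tolerances exhaust the exceptional set.\<close>
  define S where "S n = {x \<in> {a..b}. \<forall>d>0. \<exists>y\<in>{a..b}. \<bar>y - x\<bar> < d \<and> bad n x y}" for n
  have "negligible (S n)" for n
    unfolding negligible_outer_le
  proof (intro allI impI)
    fix e :: real
    assume "e > 0"
    \<comment> \<open>The 10 is the Vitali enlargement 5 times the ratio 2 of length to radius of a
      ball; \<open>Suc n\<close> appears because an interval of radius \<open>r x\<close> carries a
      Henstock error of at least \<open>r x / Suc n\<close>.\<close>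
    define e' where "e' = e / (10 * real (Suc n))"
    have "e' > 0"
      using \<open>e > 0\<close> by (simp add: e'_def)
    then obtain \<gamma> where \<gamma>: "gauge \<gamma>"
      and hen: "\<And>p. \<lbrakk>p tagged_partial_division_of (cbox a b); \<gamma> fine p\<rbrakk>
          \<Longrightarrow> (\<Sum>(x,K)\<in>p. norm (measure lborel K *\<^sub>R f x - integral K f)) < e'"
      using Henstock_lemma[of f a b e'] f by auto
    \<comment> \<open>The cap 1 bounds the radii, as the covering lemma requires; the inclusion in
      \<open>\<gamma> x\<close> will make the tagged intervals fine.\<close>
    have "\<exists>y\<in>{a..b}. \<bar>y - x\<bar> < 1 \<and> cball x \<bar>y - x\<bar> \<subseteq> \<gamma> x \<and> bad n x y" if xS: "x \<in> S n" for x
    proof -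
      have "open (\<gamma> x)" "x \<in> \<gamma> x"
        using \<gamma> by (auto simp: gauge_def)
      then obtain d where d: "d > 0" "cball x d \<subseteq> \<gamma> x"
        using open_contains_cball by blast
      moreover have "min 1 d > 0"
        using d by simp
      then obtain y where y: "y \<in> {a..b}" "\<bar>y - x\<bar> < min 1 d" "bad n x y"
        using xS unfolding S_def by blast
      moreover have "cball x \<bar>y - x\<bar> \<subseteq> cball x d"
        using y by (intro subset_cball) auto
      ultimately show ?thesis
        by (intro bexI[of _ y]) auto
    qed
    then obtain y where y: "\<And>x. x \<in> S n \<Longrightarrow> y x \<in> {a..b}" "\<And>x. x \<in> S n \<Longrightarrow> \<bar>y x - x\<bar> < 1"
      "\<And>x. x \<in> S n \<Longrightarrow> cball x \<bar>y x - x\<bar> \<subseteq> \<gamma> x" "\<And>x. x \<in> S n \<Longrightarrow> bad n x (y x)"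
      by metis
    define r where "r x = \<bar>y x - x\<bar>" for x
    have r: "0 < r x \<and> r x \<le> 1" if "x \<in> S n" for x
      using y(2,4)[OF that] by (auto simp: r_def bad_def)
    have cov: "S n \<subseteq> (\<Union>i\<in>S n. cball i (r i))"
      using r by force
    obtain C where C: "countable C" "C \<subseteq> S n"
      "pairwise (\<lambda>i j. disjnt (cball i (r i)) (cball j (r j))) C"
      "S n \<subseteq> (\<Union>i\<in>C. cball i (5 * r i))"
      by (rule Vitali_covering_lemma_cballs[OF cov, of 1]) (use r in auto)
    \<comment> \<open>The part of the ball between \<open>x\<close> and \<open>y x\<close>: the
      increment of \<open>G\<close> is the integral over it, and disjointness is inherited from the
      balls.\<close>
    define I where "I x = {min x (y x)..max x (y x)}" for x
    have I_sub: "I x \<subseteq> cball x (r x)" for x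
      by (auto simp: I_def r_def dist_real_def)
    have finbound: "(\<Sum>i\<in>D. 10 * r i) \<le> e" if D: "D \<subseteq> C" "finite D" for D
    proof -
      define p where "p = (\<lambda>x. (x, I x)) ` D"
      have DS: "D \<subseteq> S n"
        using D C by auto
      have "p tagged_partial_division_of (cbox a b)"
        unfolding tagged_partial_division_of_def
      proof (intro conjI allI impI)
        show "finite p"
          using D by (simp add: p_def)
        fix x K
        assume "(x, K) \<in> p"
        then have x: "x \<in> D" "K = I x"
          by (auto simp: p_def)
        show "x \<in> K"
          using x by (auto simp: I_def)
        show "K \<subseteq> cbox a b"
          using x y(1)[of x] DS by (auto simp: I_def S_def)
        show "\<exists>a b. K = cbox a b"
          using x by (auto simp: I_def)
      next
        fix x K x' K'
        assume "(x, K) \<in> p \<and> (x', K') \<in> p \<and> (x, K) \<noteq> (x', K')"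
        then have x: "x \<in> D" "K = I x" and x': "x' \<in> D" "K' = I x'" and ne: "(x, K) \<noteq> (x', K')"
          by (auto simp: p_def)
        have "x \<noteq> x'"
          using ne x x'
          by auto
        then have "disjnt (cball x (r x)) (cball x' (r x'))"
          using C(3) x x' D by (auto simp: pairwise_def)
        then have "I x \<inter> I x' = {}"
          using I_sub[of x] I_sub[of x'] by (auto simp: disjnt_def)
        then show "interior K \<inter> interior K' = {}"
          using x x' interior_subset by blast
      qed
      moreover have "\<gamma> fine p"
        unfolding fine_def
      proof safe
        fix x K z
        assume "(x, K) \<in> p" "z \<in> K"
        then have "x \<in> D" "z \<in> I x"
          by (auto simp: p_def)
        then show "z \<in> \<gamma> x"
          using y(3)[of x] DS I_sub[of x] by (auto simp: r_def)
      qed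
      ultimately have "(\<Sum>(x,K)\<in>p. norm (measure lborel K *\<^sub>R f x - integral K f)) < e'"
        by (rule hen)
      also have "(\<Sum>(x,K)\<in>p. norm (measure lborel K *\<^sub>R f x - integral K f))
          = (\<Sum>x\<in>D. norm (measure lborel (I x) *\<^sub>R f x - integral (I x) f))"
        unfolding p_def by (subst sum.reindex) (auto simp: inj_on_def)
      finally have *: "(\<Sum>x\<in>D. norm (measure lborel (I x) *\<^sub>R f x - integral (I x) f)) < e'" .
      have "r x / real (Suc n) \<le> norm (measure lborel (I x) *\<^sub>R f x - integral (I x) f)" if "x \<in> D" for x
      proof (cases "x \<le> y x")
        case True
        have "integral (I x) f = G (y x) - G x"
          using indefinite_integral_diff[OF f, of x "y x"] True y(1)[of x] that DS
          by (auto simp: I_def G_def S_def min_def max_def)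
        moreover have "measure lborel (I x) = y x - x"
          using True by (simp add: I_def)
        ultimately show ?thesis
          using y(4)[of x] that DS by (auto simp: bad_def r_def norm_minus_commute)
      next
        case False
        have "integral (I x) f = G x - G (y x)"
          using indefinite_integral_diff[OF f, of "y x" x] False y(1)[of x] that DS
          by (auto simp: I_def G_def S_def min_def max_def)
        moreover have "measure lborel (I x) = x - y x"
          using False by (simp add: I_def)
        ultimately have "measure lborel (I x) *\<^sub>R f x - integral (I x) f = G (y x) - G x - (y x - x) *\<^sub>R f x"
          by (simp add: scaleR_left_diff_distrib)
        then show ?thesis
          using y(4)[of x] that DS by (auto simp: bad_def r_def)
      qed
      then have "(\<Sum>x\<in>D. r x / real (Suc n))
          \<le> (\<Sum>x\<in>D. norm (measure lborel (I x) *\<^sub>R f x - integral (I x) f))"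
        by (rule sum_mono)
      with * have "(\<Sum>x\<in>D. r x / real (Suc n)) < e'"
        by (rule le_less_trans[rotated])
      then have "sum r D / real (Suc n) < e / 10 / real (Suc n)"
        by (simp add: e'_def sum_divide_distrib del: of_nat_Suc)
      then have "sum r D < e / 10"
        by (metis divide_right_mono not_less of_nat_0_le_iff)
      then show ?thesis
        by (simp add: sum_distrib_left[symmetric])
    qed
    define B where "B i = cball i (5 * r i)" for i
    have "measure lebesgue (\<Union>i\<in>D. B i) \<le> e" if D: "D \<subseteq> C" "finite D" for D
    proof -
      have "measure lebesgue (\<Union>i\<in>D. B i) \<le> (\<Sum>i\<in>D. measure lebesgue (B i))"
        using D by (intro measure_UNION_le) (auto simp: B_def)
      also have "\<dots> = (\<Sum>i\<in>D. 10 * r i)"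
        using D C r by (intro sum.cong) (auto simp: B_def cball_eq_atLeastAtMost r_def)
      finally show ?thesis
        using finbound[OF D] by simp
    qed
    then have "(\<Union>i\<in>C. B i) \<in> lmeasurable" "measure lebesgue (\<Union>i\<in>C. B i) \<le> e"
      using C(1) fmeasurable_UN_bound[of C B lebesgue e] measure_UN_bound[of C B lebesgue e]
      by (auto simp: B_def)
    then show "\<exists>T. S n \<subseteq> T \<and> T \<in> lmeasurable \<and> measure lebesgue T \<le> e"
      using C(4) unfolding B_def by blast
  qed
  then have "negligible (\<Union>n. S n)"
    by (intro negligible_countable_Union) auto
  moreover have "x \<in> (\<Union>n. S n)"
    if x: "x \<in> {a..b}" and nd: "\<not> (G has_vector_derivative f x) (at x within {a..b})" for x
  proof -
    obtain e where e: "e > 0" and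
      nb: "\<And>d. d > 0 \<Longrightarrow> \<exists>y\<in>{a..b}. norm (y - x) < d \<and>
        \<not> norm (G y - G x - (y - x) *\<^sub>R f x) \<le> e * norm (y - x)"
      using nd unfolding has_vector_derivative_def has_derivative_within_alt
      by (auto simp: bounded_linear_scaleR_left)
    obtain n where n: "inverse (real (Suc n)) < e"
      using reals_Archimedean[OF e] by auto
    have le: "\<bar>y - x\<bar> / real (Suc n) \<le> e * \<bar>y - x\<bar>" for y
      using n mult_right_mono[of "inverse (real (Suc n))" e "\<bar>y - x\<bar>"] by (simp add: divide_inverse_commute)
    have "\<exists>y\<in>{a..b}. \<bar>y - x\<bar> < d \<and> bad n x y" if d: "d > 0" for d
    proof -
      obtain y where y: "y \<in> {a..b}" "norm (y - x) < d"
        "\<not> norm (G y - G x - (y - x) *\<^sub>R f x) \<le> e * norm (y - x)"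
        using nb[OF d] by blast
      then have "bad n x y"
        using le[of y] by (simp add: bad_def)
      then show ?thesis
        using y by auto
    qed
    then have "x \<in> S n"
      using x unfolding S_def by blast
    then show ?thesis
      by blast
  qed
  ultimately show ?thesis
    by (elim negligible_subset) (auto simp: G_def[abs_def])
qed

section \<open>Square-integrable functions and absolute continuity\<close>

lemma integrable_on_subinterval_lebesgue_on:
  fixes g :: "real \<Rightarrow> 'a::euclidean_space"
  assumes "integrable (lebesgue_on {0..T}) g" "0 \<le> s" "t \<le> T"
  shows "g integrable_on {s..t}"
  using assms integrable_subinterval[of 0 T g s t] integrable_on_lebesgue_on[of "{s..t}" g] by auto

text \<open>The interval has finite measure, so the majorant 1 + |v|^2 of |v| is integrable.\<close>

lemma L2_integrable:
  fixes f :: "real \<Rightarrow> 'a::euclidean_space"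
  assumes "L2 T f"
  shows "integrable (lebesgue_on {0..T}) f"
proof (rule Bochner_Integration.integrable_bound)
  show "integrable (lebesgue_on {0..T}) (\<lambda>t. 1 + (norm (f t))\<^sup>2)"
    using assms by (auto simp: L2_def)
  show "f \<in> borel_measurable (lebesgue_on {0..T})"
    using assms by (simp add: L2_def)
  have "norm v \<le> 1 + (norm v)\<^sup>2" for v :: 'a
  proof -
    have "2 * norm v \<le> (norm v)\<^sup>2 + 1"
      using zero_le_power2[of "norm v - 1"] by (simp add: power2_diff)
    then show ?thesis
      using norm_ge_zero[of v] by linarith
  qed
  then show "AE t in lebesgue_on {0..T}. norm (f t) \<le> norm (1 + (norm (f t))\<^sup>2)"
    by simp
qed

lemma L2_bounded_by:
  fixes f :: "real \<Rightarrow> 'a::euclidean_space" and h :: "real \<Rightarrow> real"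
  assumes "f \<in> borel_measurable (lebesgue_on {0..T})" "integrable (lebesgue_on {0..T}) h"
    and "AE t in lebesgue_on {0..T}. (norm (f t))\<^sup>2 \<le> h t"
  shows "L2 T f"
  unfolding L2_def
proof
  note [measurable] = assms(1)
  show "integrable (lebesgue_on {0..T}) (\<lambda>t. (norm (f t))\<^sup>2)"
  proof (rule Bochner_Integration.integrable_bound[OF assms(2)])
    show "AE t in lebesgue_on {0..T}. norm ((norm (f t))\<^sup>2) \<le> norm (h t)"
      using assms(3) by (auto elim: eventually_mono)
  qed measurable
qed (use assms in auto)

lemma norm_add_power2_le:
  fixes u v :: "'a::real_inner"
  shows "(norm (u + v))\<^sup>2 \<le> 2 * (norm u)\<^sup>2 + 2 * (norm v)\<^sup>2"
proof -
  have "0 \<le> (norm (u - v))\<^sup>2"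
    by simp
  then show ?thesis
    by (simp add: power2_norm_eq_inner inner_simps inner_commute)
qed

lemma L2_add:
  fixes f g :: "real \<Rightarrow> 'a::euclidean_space"
  assumes "L2 T f" "L2 T g"
  shows "L2 T (\<lambda>t. f t + g t)"
proof (rule L2_bounded_by)
  show "integrable (lebesgue_on {0..T}) (\<lambda>t. 2 * (norm (f t))\<^sup>2 + 2 * (norm (g t))\<^sup>2)"
    using assms by (auto simp: L2_def)
qed (use assms in \<open>auto simp: L2_def norm_add_power2_le\<close>)

lemma L2_scaleR:
  fixes f :: "real \<Rightarrow> 'a::euclidean_space"
  assumes "L2 T f"
  shows "L2 T (\<lambda>t. c *\<^sub>R f t)"
  using assms by (auto simp: L2_def power_mult_distrib)

lemma L2_diff:
  fixes f g :: "real \<Rightarrow> 'a::euclidean_space"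
  assumes "L2 T f" "L2 T g"
  shows "L2 T (\<lambda>t. f t - g t)"
  using L2_add[OF assms(1) L2_scaleR[OF assms(2), of "-1"]] by simp

lemma L2_bounded:
  fixes f :: "real \<Rightarrow> 'a::euclidean_space"
  assumes "f \<in> borel_measurable (lebesgue_on {0..T})" "\<And>t. t \<in> {0..T} \<Longrightarrow> norm (f t) \<le> B"
  shows "L2 T f"
proof (rule L2_bounded_by[OF assms(1)])
  show "integrable (lebesgue_on {0..T}) (\<lambda>t. B\<^sup>2)"
    by simp
  show "AE t in lebesgue_on {0..T}. (norm (f t))\<^sup>2 \<le> B\<^sup>2"
    using assms(2) by (intro AE_I2) (auto intro!: power_mono)
qed

lemma L2_continuous:
  fixes f :: "real \<Rightarrow> 'a::euclidean_space"
  assumes "continuous_on {0..T} f"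
  shows "L2 T f"
proof -
  have "bounded (f ` {0..T})"
    using assms by (intro compact_imp_bounded compact_continuous_image) auto
  then obtain B where "\<forall>t\<in>{0..T}. norm (f t) \<le> B"
    by (auto simp: bounded_iff)
  then show ?thesis
    using assms by (intro L2_bounded[of f T B] continuous_imp_measurable_on_sets_lebesgue) auto
qed

lemma L2_cong_AE:
  fixes f g :: "real \<Rightarrow> 'a::euclidean_space"
  assumes "L2 T f" "g \<in> borel_measurable (lebesgue_on {0..T})"
    and "AE t in lebesgue_on {0..T}. g t = f t"
  shows "L2 T g"
proof (rule L2_bounded_by[OF assms(2)])
  show "integrable (lebesgue_on {0..T}) (\<lambda>t. (norm (f t))\<^sup>2)"
    using assms(1) by (simp add: L2_def)
  show "AE t in lebesgue_on {0..T}. (norm (g t))\<^sup>2 \<le> (norm (f t))\<^sup>2"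
    using assms(3) by (auto elim: eventually_mono)
qed

lemma abs_inner_le_power2:
  fixes u v :: "'a::real_inner"
  shows "\<bar>u \<bullet> v\<bar> \<le> (norm u)\<^sup>2 + (norm v)\<^sup>2"
proof -
  have "0 \<le> (norm (u - v))\<^sup>2" "0 \<le> (norm (u + v))\<^sup>2" "0 \<le> (norm u)\<^sup>2" "0 \<le> (norm v)\<^sup>2"
    by simp_all
  then show ?thesis
    unfolding power2_norm_eq_inner inner_simps by (simp add: inner_commute)
qed

lemma L2_inner_integrable:
  fixes f g :: "real \<Rightarrow> 'a::euclidean_space"
  assumes "L2 T f" "L2 T g"
  shows "integrable (lebesgue_on {0..T}) (\<lambda>t. f t \<bullet> g t)"
proof (rule Bochner_Integration.integrable_bound)
  show "integrable (lebesgue_on {0..T}) (\<lambda>t. (norm (f t))\<^sup>2 + (norm (g t))\<^sup>2)"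
    using assms by (auto simp: L2_def)
qed (use assms in \<open>auto simp: L2_def abs_inner_le_power2 intro!: AE_I2 borel_measurable_inner\<close>)

lemma abs_continuous_on_imp_continuous_on:
  assumes "abs_continuous_on I x"
  shows "continuous_on I x"
  unfolding continuous_on_iff
proof (intro ballI allI impI)
  fix t e :: real
  assume t: "t \<in> I" and "e > 0"
  then obtain d where "d > 0" and d: "\<And>(n::nat) a b. (\<forall>i<n. a i \<in> I \<and> b i \<in> I \<and> a i \<le> b i) \<and>
        disjoint_family_on (\<lambda>i. {a i<..<b i}) {..<n} \<and> (\<Sum>i<n. b i - a i) < d
        \<Longrightarrow> (\<Sum>i<n. norm (x (b i) - x (a i))) < e"
    using assms unfolding abs_continuous_on_def by meson
  have "dist (x s) (x t) < e" if "s \<in> I" "dist s t < d" for s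
    using d[of 1 "\<lambda>_. min s t" "\<lambda>_. max s t"] t that
    by (cases "s \<le> t") (auto simp: disjoint_family_on_def dist_norm norm_minus_commute)
  then show "\<exists>d>0. \<forall>s\<in>I. dist s t < d \<longrightarrow> dist (x s) (x t) < e"
    using \<open>d > 0\<close> by blast
qed

text \<open>Young's inequality with a free weight \<open>l\<close>, in the role of Cauchy-Schwarz.
  It is additive over intervals; \<open>l\<close> is later chosen to make the energy term small, and
  then the length to make the other term small.\<close>

lemma L2_norm_integral_le:
  fixes g :: "real \<Rightarrow> 'a::euclidean_space"
  assumes g: "L2 T g" and st: "0 \<le> s" "s \<le> t" "t \<le> T" and "l > 0"
  shows "norm (integral {s..t} g) \<le> (t - s) / l + l * integral {s..t} (\<lambda>u. (norm (g u))\<^sup>2)"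
proof -
  have young: "norm v \<le> 1 / l + l * (norm v)\<^sup>2" for v :: 'a
  proof -
    have "0 \<le> (l * norm v - 1)\<^sup>2 / l + norm v"
      using \<open>l > 0\<close> by simp
    also have "\<dots> = 1 / l + l * (norm v)\<^sup>2 - norm v"
      using \<open>l > 0\<close> by (simp add: field_simps power2_eq_square)
    finally show ?thesis
      by simp
  qed
  have "integrable (lebesgue_on {0..T}) (\<lambda>t. (norm (g t))\<^sup>2)"
    using g by (simp add: L2_def)
  then have int: "(\<lambda>t. (norm (g t))\<^sup>2) integrable_on {s..t}" "g integrable_on {s..t}"
    using st L2_integrable[OF g] integrable_on_subinterval_lebesgue_on by blast+
  then have "norm (integral {s..t} g) \<le> integral {s..t} (\<lambda>t. 1 / l + l * (norm (g t))\<^sup>2)"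
    using young
    by (intro Henstock_Kurzweil_Integration.integral_norm_bound_integral integrable_add
        integrable_const_ivl integrable_on_mult_right) auto
  also have "\<dots> = (t - s) / l + l * integral {s..t} (\<lambda>t. (norm (g t))\<^sup>2)"
    using int st
    by (subst Henstock_Kurzweil_Integration.integral_add) (auto intro: integrable_on_mult_right)
  finally show ?thesis .
qed

lemma abs_continuous_on_indefinite_integral:
  fixes g :: "real \<Rightarrow> 'a::euclidean_space"
  assumes g: "L2 T g" and x: "\<And>t. t \<in> {0..T} \<Longrightarrow> x t = c + integral {0..t} g"
  shows "abs_continuous_on {0..T} x"
  unfolding abs_continuous_on_def
proof (intro allI impI)
  fix e :: real
  assume "e > 0"
  let ?M = "lebesgue_on {0..T}"
  have int: "integrable ?M g"
    using g by (rule L2_integrable)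
  have int2: "integrable ?M (\<lambda>t. (norm (g t))\<^sup>2)"
    using g by (simp add: L2_def)
  \<comment> \<open>The added 1 keeps \<open>K\<close> positive when \<open>g\<close>
    vanishes.\<close>
  define K where "K = (LINT t|?M. (norm (g t))\<^sup>2) + 1"
  have "K > 0"
    unfolding K_def by (simp add: add_nonneg_pos)
  \<comment> \<open>With this \<open>l\<close> and the \<open>d\<close> below, \<open>d / l\<close>
    and \<open>l * K\<close> are both \<open>e / 2\<close>.\<close>
  define l where "l = e / (2 * K)"
  have "l > 0"
    using \<open>e > 0\<close> \<open>K > 0\<close> by (simp add: l_def)
  define d where "d = l * e / 2"
  show "\<exists>d>0. \<forall>(n::nat) a b. (\<forall>i<n. a i \<in> {0..T} \<and> b i \<in> {0..T} \<and> a i \<le> b i) \<and>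
        disjoint_family_on (\<lambda>i. {a i<..<b i}) {..<n} \<and> (\<Sum>i<n. b i - a i) < d
        \<longrightarrow> (\<Sum>i<n. norm (x (b i) - x (a i))) < e"
  proof (intro exI[of _ d] conjI allI impI)
    show "d > 0"
      using \<open>l > 0\<close> \<open>e > 0\<close> by (simp add: d_def)
    fix n :: nat and a b
    assume "(\<forall>i<n. a i \<in> {0..T} \<and> b i \<in> {0..T} \<and> a i \<le> b i) \<and>
        disjoint_family_on (\<lambda>i. {a i<..<b i}) {..<n} \<and> (\<Sum>i<n. b i - a i) < d"
    then have ab: "\<And>i. i < n \<Longrightarrow> a i \<in> {0..T} \<and> b i \<in> {0..T} \<and> a i \<le> b i"
      and dis: "disjoint_family_on (\<lambda>i. {a i<..<b i}) {..<n}" and small: "(\<Sum>i<n. b i - a i) < d"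
      by auto
    have "norm (x (b i) - x (a i)) \<le> (b i - a i) / l + l * integral {a i..b i} (\<lambda>t. (norm (g t))\<^sup>2)"
      if "i < n" for i
    proof -
      have "g integrable_on {0..T}"
        by (rule integrable_on_subinterval_lebesgue_on[OF int]) auto
      then have "x (b i) - x (a i) = integral {a i..b i} g"
        using ab[OF that] x indefinite_integral_diff[of g 0 T "a i" "b i"] by simp
      then show ?thesis
        using L2_norm_integral_le[OF g _ _ _ \<open>l > 0\<close>, of "a i" "b i"] ab[OF that] by simp
    qed
    then have "(\<Sum>i<n. norm (x (b i) - x (a i)))
        \<le> (\<Sum>i<n. (b i - a i) / l + l * integral {a i..b i} (\<lambda>t. (norm (g t))\<^sup>2))"
      by (intro sum_mono) auto
    then have "(\<Sum>i<n. norm (x (b i) - x (a i)))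
        \<le> (\<Sum>i<n. b i - a i) / l + l * (\<Sum>i<n. integral {a i..b i} (\<lambda>t. (norm (g t))\<^sup>2))"
      by (simp only: sum.distrib sum_divide_distrib[symmetric] sum_distrib_left[symmetric])
    moreover have "(\<Sum>i<n. integral {a i..b i} (\<lambda>t. (norm (g t))\<^sup>2)) \<le> (LINT t|?M. (norm (g t))\<^sup>2)"
    proof -
      have "((\<lambda>t. (norm (g t))\<^sup>2) has_integral (\<Sum>i<n. integral {a i..b i} (\<lambda>t. (norm (g t))\<^sup>2)))
          (\<Union>i\<in>{..<n}. {a i..b i})"
      proof (rule has_integral_UN)
        \<comment> \<open>Disjointness is given for the open intervals only; the closed ones may
          share endpoints.\<close>
        show "pairwise (\<lambda>i j. negligible ({a i..b i} \<inter> {a j..b j})) {..<n}"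
        proof (intro pairwiseI)
          fix i j
          assume "i \<in> {..<n}" "j \<in> {..<n}" "i \<noteq> j"
          then have "{a i<..<b i} \<inter> {a j<..<b j} = {}"
            using disjoint_family_onD[OF dis] by blast
          moreover have "{a i..b i} \<inter> {a j..b j}
              \<subseteq> ({a i<..<b i} \<inter> {a j<..<b j}) \<union> {a i, b i, a j, b j}"
            by (intro subsetI) (simp; linarith)
          ultimately have "{a i..b i} \<inter> {a j..b j} \<subseteq> {a i, b i, a j, b j}"
            by blast
          then show "negligible ({a i..b i} \<inter> {a j..b j})"
            by (rule negligible_subset[rotated]) (intro negligible_finite; simp)
        qed
      qed (use ab in \<open>auto intro!: integrable_integral integrable_on_subinterval_lebesgue_on[OF int2]\<close>)
      moreover have "((\<lambda>t. (norm (g t))\<^sup>2) has_integral (LINT t|?M. (norm (g t))\<^sup>2)) {0..T}"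
        using int2 by (intro has_integral_integral_lebesgue_on) auto
      ultimately show ?thesis
        by (rule has_integral_subset_le[rotated]) (use ab in force)+
    qed
    ultimately have "(\<Sum>i<n. norm (x (b i) - x (a i)))
        \<le> (\<Sum>i<n. b i - a i) / l + l * (LINT t|?M. (norm (g t))\<^sup>2)"
      using \<open>l > 0\<close> by (smt (verit) mult_left_mono)
    also have "\<dots> < d / l + l * K"
      using small \<open>l > 0\<close> by (intro add_strict_mono divide_strict_right_mono mult_strict_left_mono) (auto simp: K_def)
    also have "\<dots> = e"
      using \<open>l > 0\<close> \<open>K > 0\<close> by (simp add: d_def l_def)
    finally show "(\<Sum>i<n. norm (x (b i) - x (a i))) < e" .
  qed
qed

section \<open>Weak derivatives and integral representation\<close>

text \<open>The integral of a tent is a quadratic spline; its rescalings give \<open>C\<^sup>1\<close> approximations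
  of indicator functions of intervals.\<close>

definition tent :: "real \<Rightarrow> real" where
  "tent u = max 0 u - 2 * max 0 (u - 1) + max 0 (u - 2)"

definition ramp :: "real \<Rightarrow> real" where
  "ramp u = ((max 0 u)\<^sup>2 - 2 * (max 0 (u - 1))\<^sup>2 + (max 0 (u - 2))\<^sup>2) / 2"

text \<open>Bounding the remainder by \<open>h\<^sup>2\<close> for all signs of \<open>u\<close> and
  \<open>u + h\<close> treats the kink at 0 together with the smooth points.\<close>

lemma has_real_derivative_pos_part_power2:
  "((\<lambda>u. (max 0 u)\<^sup>2) has_real_derivative 2 * max 0 u) (at u)"
proof -
  have *: "\<bar>(max 0 (u + h))\<^sup>2 - (max 0 u)\<^sup>2 - 2 * max 0 u * h\<bar> \<le> h\<^sup>2" for h :: real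
  proof (cases "0 \<le> u"; cases "0 \<le> u + h")
    assume "0 \<le> u" "0 \<le> u + h"
    then show ?thesis
      by (simp add: max_def power2_sum)
  next
    assume u: "0 \<le> u" "\<not> 0 \<le> u + h"
    then have "u * (u + 2 * h) \<le> 0"
      by (intro mult_nonneg_nonpos) auto
    moreover have "0 \<le> (u + h)\<^sup>2"
      by simp
    ultimately show ?thesis
      using u by (simp add: max_def power2_eq_square algebra_simps)
  next
    assume u: "\<not> 0 \<le> u" "0 \<le> u + h"
    then have "(u + h)\<^sup>2 \<le> h\<^sup>2"
      by (intro power_mono) auto
    then show ?thesis
      using u by (simp add: max_def)
  next
    assume "\<not> 0 \<le> u" "\<not> 0 \<le> u + h"
    then show ?thesis
      by (simp add: max_def)
  qed
  have "((\<lambda>h. ((max 0 (u + h))\<^sup>2 - (max 0 u)\<^sup>2) / h - 2 * max 0 u) \<longlongrightarrow> 0) (at 0)"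
  proof (rule Lim_null_comparison)
    show "((\<lambda>h::real. \<bar>h\<bar>) \<longlongrightarrow> 0) (at 0)"
      by (rule tendsto_eq_intros refl | simp)+
    have "norm (((max 0 (u + h))\<^sup>2 - (max 0 u)\<^sup>2) / h - 2 * max 0 u) \<le> \<bar>h\<bar>" if "h \<noteq> 0" for h
    proof -
      have "((max 0 (u + h))\<^sup>2 - (max 0 u)\<^sup>2) / h - 2 * max 0 u
          = ((max 0 (u + h))\<^sup>2 - (max 0 u)\<^sup>2 - 2 * max 0 u * h) / h"
        using that by (simp add: field_simps)
      also have "norm \<dots> \<le> h\<^sup>2 / \<bar>h\<bar>"
        using * by (simp add: divide_right_mono)
      also have "h\<^sup>2 / \<bar>h\<bar> = \<bar>h\<bar>"
        using that by (cases "0 < h") (simp_all add: power2_eq_square)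
      finally show ?thesis .
    qed
    then show "\<forall>\<^sub>F h in at 0. norm (((max 0 (u + h))\<^sup>2 - (max 0 u)\<^sup>2) / h - 2 * max 0 u) \<le> \<bar>h\<bar>"
      by (simp add: eventually_at_filter)
  qed
  then show ?thesis
    unfolding DERIV_def by (rule LIM_zero_cancel)
qed

lemma ramp_has_real_derivative: "(ramp has_real_derivative tent u) (at u)"
proof -
  have shift: "((\<lambda>u. (max 0 (u - c))\<^sup>2) has_real_derivative 2 * max 0 (u - c)) (at u)" for c :: real
    by (rule DERIV_cong[OF DERIV_chain2[OF has_real_derivative_pos_part_power2]])
       (auto intro!: derivative_eq_intros)
  have "((\<lambda>u. ((max 0 u)\<^sup>2 - 2 * (max 0 (u - 1))\<^sup>2 + (max 0 (u - 2))\<^sup>2) / 2)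
      has_real_derivative (2 * max 0 u - 2 * (2 * max 0 (u - 1)) + 2 * max 0 (u - 2)) / 2) (at u)"
    by (intro DERIV_cdivide DERIV_add DERIV_diff DERIV_cmult shift has_real_derivative_pos_part_power2)
  then show ?thesis
    unfolding ramp_def[abs_def] tent_def by (rule DERIV_cong) simp
qed

lemma continuous_on_tent [continuous_intros]:
  "continuous_on A f \<Longrightarrow> continuous_on A (\<lambda>u. tent (f u))"
  unfolding tent_def by (intro continuous_intros)

lemma tent_nonneg: "0 \<le> tent u"
  by (auto simp: tent_def max_def)

lemma tent_eq_0: "u \<le> 0 \<or> 2 \<le> u \<Longrightarrow> tent u = 0"
  by (auto simp: tent_def max_def)

lemma ramp_eq_0: "u \<le> 0 \<Longrightarrow> ramp u = 0"
  by (auto simp: ramp_def max_def)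

lemma ramp_eq_1: "2 \<le> u \<Longrightarrow> ramp u = 1"
  by (auto simp: ramp_def max_def power2_eq_square algebra_simps)

lemma ramp_mono: "u \<le> v \<Longrightarrow> ramp u \<le> ramp v"
  by (rule DERIV_nonneg_imp_nondecreasing) (auto intro!: exI ramp_has_real_derivative tent_nonneg)

lemma ramp_bounds: "0 \<le> ramp u" "ramp u \<le> 1"
  using ramp_mono[of "min 0 u" u] ramp_mono[of u "max 2 u"] ramp_eq_0[of "min 0 u"] ramp_eq_1[of "max 2 u"]
  by linarith+

lemma scaled_tent_integral:
  assumes "n > 0" "0 \<le> s" "s + 2 / n \<le> T"
  shows "(LINT u|lebesgue_on {0..T}. n * tent (n * (u - s))) = 1"
proof -
  have "0 < 2 / n"
    using assms by simp
  then have "0 \<le> T"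
    using assms by linarith
  have cont: "continuous_on {0..T} (\<lambda>u. n * tent (n * (u - s)))"
    by (intro continuous_intros)
  have "((\<lambda>u. ramp (n * (u - s))) has_real_derivative tent (n * (u - s)) * n) (at u)" for u
    by (rule DERIV_chain2[OF ramp_has_real_derivative]) (auto intro!: derivative_eq_intros)
  then have "((\<lambda>u. n * tent (n * (u - s))) has_integral ramp (n * (T - s)) - ramp (n * (0 - s))) {0..T}"
    using \<open>0 \<le> T\<close>
    by (intro fundamental_theorem_of_calculus)
       (auto simp: has_real_derivative_iff_has_vector_derivative[symmetric] mult.commute intro: DERIV_subset)
  moreover have "ramp (n * (T - s)) = 1"
    using assms by (intro ramp_eq_1) (simp add: field_simps)
  moreover have "ramp (n * (0 - s)) = 0"
    using assms by (intro ramp_eq_0) simp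
  ultimately have "integral {0..T} (\<lambda>u. n * tent (n * (u - s))) = 1"
    by (intro integral_unique) simp
  then show ?thesis
    using lebesgue_integral_eq_integral[OF continuous_imp_integrable_real[OF cont]] by simp
qed

text \<open>The scaled tents form a one-sided approximate identity, supported in [s, s + 2/n]; hence
  s = 0 is allowed but s = T is not.\<close>

lemma scaled_tent_tendsto:
  fixes x :: "real \<Rightarrow> 'a::euclidean_space"
  assumes x: "continuous_on {0..T} x" and s: "0 \<le> s" "s < T"
  shows "(\<lambda>n. LINT u|lebesgue_on {0..T}. (real n * tent (real n * (u - s))) *\<^sub>R x u)
    \<longlonglongrightarrow> x s"
  unfolding tendsto_iff
proof (intro allI impI)
  fix e :: real
  assume "e > 0"
  then obtain d where "d > 0" and d: "\<And>u. u \<in> {0..T} \<Longrightarrow> dist u s < d \<Longrightarrow> dist (x u) (x s) < e / 2"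
    using x s unfolding continuous_on_iff by (metis atLeastAtMost_iff half_gt_zero less_imp_le)
  \<comment> \<open>The support must be short enough for continuity at \<open>s\<close> and must end
    before \<open>T\<close>, so that the whole mass 1 lies in the interval.\<close>
  have "min d (T - s) > 0"
    using \<open>d > 0\<close> s by simp
  then obtain N :: nat where N: "2 / min d (T - s) < real N"
    using reals_Archimedean2 by blast
  have "dist (LINT u|lebesgue_on {0..T}. (real n * tent (real n * (u - s))) *\<^sub>R x u) (x s) < e"
    if "n \<ge> N" for n
  proof -
    define \<delta> where "\<delta> u = real n * tent (real n * (u - s))" for u
    have "2 / min d (T - s) < real n"
      using N that by linarith
    moreover from this have "n > 0"
      using \<open>min d (T - s) > 0\<close> by (smt (verit) divide_nonneg_pos of_nat_0_less_iff)
    moreover have "2 / real n < c" if "2 / c < real n" "0 < c" "0 < n" for c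
      using that by (simp add: field_simps)
    ultimately have small: "2 / real n < min d (T - s)"
      using \<open>min d (T - s) > 0\<close> by blast
    have cont: "continuous_on {0..T} \<delta>"
      unfolding \<delta>_def by (intro continuous_intros)
    have one: "(LINT u|lebesgue_on {0..T}. \<delta> u) = 1"
      unfolding \<delta>_def using \<open>n > 0\<close> small s by (intro scaled_tent_integral) auto
    have int: "integrable (lebesgue_on {0..T}) \<delta>" "integrable (lebesgue_on {0..T}) (\<lambda>u. \<delta> u *\<^sub>R x u)"
      "integrable (lebesgue_on {0..T}) (\<lambda>u. \<delta> u *\<^sub>R (x u - x s))"
      by (intro continuous_imp_integrable_real continuous_intros cont x)+
    have "(LINT u|lebesgue_on {0..T}. \<delta> u *\<^sub>R x u) - x s
        = (LINT u|lebesgue_on {0..T}. \<delta> u *\<^sub>R (x u - x s))"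
      using int one by (simp add: scaleR_diff_right)
    also have "norm \<dots> \<le> (LINT u|lebesgue_on {0..T}. \<delta> u * (e / 2))"
    proof (rule Bochner_Integration.integral_norm_bound_integral)
      show "integrable (lebesgue_on {0..T}) (\<lambda>u. \<delta> u * (e / 2))"
        using int(1) by simp
      fix u
      assume u: "u \<in> space (lebesgue_on {0..T})"
      have nonneg: "0 \<le> \<delta> u"
        by (simp add: \<delta>_def tent_nonneg)
      show "norm (\<delta> u *\<^sub>R (x u - x s)) \<le> \<delta> u * (e / 2)"
      proof (cases "\<delta> u = 0")
        case False
        then have "0 < real n * (u - s)" "real n * (u - s) < 2"
          using tent_eq_0[of "real n * (u - s)"] unfolding \<delta>_def by fastforce+
        then have "0 < u - s" "u - s < 2 / real n"
          using \<open>n > 0\<close> by (simp_all add: field_simps zero_less_mult_iff)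
        then have "dist u s < d"
          using small by (simp add: dist_real_def)
        then have "norm (x u - x s) \<le> e / 2"
          using d[of u] u by (simp add: dist_norm less_imp_le)
        then show ?thesis
          using mult_left_mono[OF _ nonneg] nonneg by fastforce
      qed simp
    qed (rule int)
    also have "\<dots> = e / 2"
      using one by simp
    finally show ?thesis
      using \<open>e > 0\<close> by (simp add: \<delta>_def dist_norm)
  qed
  then show "\<forall>\<^sub>F n in sequentially. dist (LINT u|lebesgue_on {0..T}. (real n * tent (real n * (u - s))) *\<^sub>R x u) (x s) < e"
    by (auto simp: eventually_sequentially)
qed

text \<open>For n > 0 it rises from 0 to 1 on [s, s + 2/n] and falls back on [t, t + 2/n], so its
  derivative is an approximate identity at \<open>s\<close> minus one at \<open>t\<close>.\<close>

definition plateau :: "real \<Rightarrow> real \<Rightarrow> real \<Rightarrow> real \<Rightarrow> real" where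
  "plateau n s t u = ramp (n * (u - s)) - ramp (n * (u - t))"

lemma plateau_has_real_derivative:
  "(plateau n s t has_real_derivative n * tent (n * (u - s)) - n * tent (n * (u - t))) (at u)"
proof -
  have "((\<lambda>u. ramp (n * (u - s))) has_real_derivative tent (n * (u - s)) * n) (at u)" for s
    by (rule DERIV_chain2[OF ramp_has_real_derivative]) (auto intro!: derivative_eq_intros)
  then show ?thesis
    unfolding plateau_def[abs_def] by (simp add: DERIV_diff mult.commute)
qed

lemma test_function_plateau:
  assumes "n > 0" "0 < s" "s \<le> t" "t + 2 / n < T"
  shows "test_function T (plateau n s t)"
proof -
  have der: "deriv (plateau n s t) = (\<lambda>u. n * tent (n * (u - s)) - n * tent (n * (u - t)))"
    using plateau_has_real_derivative DERIV_imp_deriv by blast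
  have outside: "plateau n s t u = 0" if "u \<notin> {s..t + 2 / n}" for u
  proof (cases "u < s")
    case True
    then show ?thesis
      using assms by (simp add: plateau_def ramp_eq_0 mult_nonneg_nonpos)
  next
    case False
    then have "u > t + 2 / n"
      using that by auto
    then have "2 \<le> n * (u - t)"
      using assms by (simp add: field_simps)
    moreover have "n * (u - t) \<le> n * (u - s)"
      using assms by simp
    ultimately show ?thesis
      by (simp add: plateau_def ramp_eq_1)
  qed
  have sub: "closure {u. plateau n s t u \<noteq> 0} \<subseteq> {s..t + 2 / n}"
    by (intro closure_minimal closed_atLeastAtMost) (use outside in blast)
  moreover have "compact (closure {u. plateau n s t u \<noteq> 0})"
    using compact_Int_closed[OF compact_Icc closed_closure, of s "t + 2 / n"] sub
    by (metis Int_absorb1)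
  moreover have "plateau n s t differentiable (at u)" for u
    using plateau_has_real_derivative real_differentiable_def by blast
  ultimately show ?thesis
    unfolding test_function_def der using assms by (auto intro!: continuous_intros)
qed

text \<open>Tested with plateaus, the left side of the weak-derivative identity tends to
  \<open>x s - x t\<close> and the right side to minus the integral of \<open>g\<close> over the
  interval. The strict bounds on \<open>s\<close> and \<open>t\<close> keep the supports inside the
  open interval for large n.\<close>

lemma weak_derivative_integral_interior:
  fixes x g :: "real \<Rightarrow> 'a::euclidean_space"
  assumes x: "continuous_on {0..T} x" and g: "integrable (lebesgue_on {0..T}) g"
    and wd: "weak_derivative T x g" and st: "0 < s" "s \<le> t" "t < T"
  shows "x t - x s = integral {s..t} g"
proof -
  let ?M = "lebesgue_on {0..T}"
  have der: "deriv (plateau n s t) = (\<lambda>u. n * tent (n * (u - s)) - n * tent (n * (u - t)))" for n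
    using plateau_has_real_derivative DERIV_imp_deriv by blast
  have int: "integrable ?M (\<lambda>u. (n * tent (n * (u - s))) *\<^sub>R x u)" for n s
    by (intro continuous_imp_integrable_real continuous_intros x)
  have "(\<lambda>n. (LINT u|?M. (real n * tent (real n * (u - s))) *\<^sub>R x u)
      - (LINT u|?M. (real n * tent (real n * (u - t))) *\<^sub>R x u)) \<longlonglongrightarrow> x s - x t"
    using st by (intro tendsto_diff scaled_tent_tendsto x) auto
  moreover have "(LINT u|?M. (real n * tent (real n * (u - s))) *\<^sub>R x u)
      - (LINT u|?M. (real n * tent (real n * (u - t))) *\<^sub>R x u)
      = (LINT u|?M. deriv (plateau (real n) s t) u *\<^sub>R x u)" for n
    using int by (simp add: der scaleR_diff_left)
  ultimately have lim1: "(\<lambda>n. LINT u|?M. deriv (plateau (real n) s t) u *\<^sub>R x u) \<longlonglongrightarrow> x s - x t"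
    by simp
  have lim2: "(\<lambda>n. LINT u|?M. plateau (real n) s t u *\<^sub>R g u)
      \<longlonglongrightarrow> (LINT u|?M. indicat_real {s<..t} u *\<^sub>R g u)"
  proof (rule integral_dominated_convergence)
    have [measurable]: "g \<in> borel_measurable ?M"
      using g by auto
    have [measurable]: "indicat_real {s<..t} \<in> borel_measurable ?M"
      by (intro measurable_restrict_space1 borel_measurable_indicator) simp
    show "(\<lambda>u. indicat_real {s<..t} u *\<^sub>R g u) \<in> borel_measurable ?M"
      by measurable
    show "(\<lambda>u. plateau (real n) s t u *\<^sub>R g u) \<in> borel_measurable ?M" for n
    proof -
      have "continuous_on {0..T} (plateau (real n) s t)"
        by (rule DERIV_continuous_on[OF has_field_derivative_at_within[OF plateau_has_real_derivative]])
      then have [measurable]: "plateau (real n) s t \<in> borel_measurable ?M"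
        by (intro continuous_imp_measurable_on_sets_lebesgue) auto
      show ?thesis
        by measurable
    qed
    show "integrable ?M (\<lambda>u. norm (g u))"
      using g by simp
    show "AE u in ?M. norm (plateau (real n) s t u *\<^sub>R g u) \<le> norm (g u)" for n
    proof (rule AE_I2)
      fix u
      have "\<bar>plateau (real n) s t u\<bar> \<le> 1"
        using ramp_bounds[of "real n * (u - s)"] ramp_bounds[of "real n * (u - t)"]
        by (auto simp: plateau_def)
      then show "norm (plateau (real n) s t u *\<^sub>R g u) \<le> norm (g u)"
        by (simp add: mult_left_le_one_le)
    qed
    \<comment> \<open>At \<open>u = s\<close> every term is 0, which is why the limit indicator is
      half-open.\<close>
    have ramp_lim: "(\<lambda>n. ramp (real n * (u - s))) \<longlonglongrightarrow> (if s < u then 1 else 0)" for u s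
    proof (cases "s < u")
      case True
      have "\<forall>\<^sub>F n in sequentially. 2 / (u - s) \<le> real n"
        using eventually_ge_at_top[of "nat \<lceil>2 / (u - s)\<rceil>"] by eventually_elim linarith
      then have "\<forall>\<^sub>F n in sequentially. ramp (real n * (u - s)) = 1"
        by eventually_elim (use True in \<open>simp add: ramp_eq_1 pos_divide_le_eq\<close>)
      then show ?thesis
        using True by (simp add: tendsto_eventually)
    qed (simp add: ramp_eq_0 mult_nonneg_nonpos)
    have "(\<lambda>n. plateau (real n) s t u) \<longlonglongrightarrow> indicat_real {s<..t} u" for u
    proof -
      have "(\<lambda>n. plateau (real n) s t u) \<longlonglongrightarrow> (if s < u then 1 else 0) - (if t < u then 1 else 0)"
        unfolding plateau_def by (intro tendsto_diff ramp_lim)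
      also have "(if s < u then 1 else 0) - (if t < u then 1 else 0) = indicat_real {s<..t} u"
        using st by (auto simp: indicator_def)
      finally show ?thesis .
    qed
    then show "AE u in ?M. (\<lambda>n. plateau (real n) s t u *\<^sub>R g u) \<longlonglongrightarrow> indicat_real {s<..t} u *\<^sub>R g u"
      by (intro AE_I2 tendsto_scaleR tendsto_const)
  qed
  obtain N :: nat where N: "2 / (T - t) < real N"
    using reals_Archimedean2 by blast
  have "(LINT u|?M. deriv (plateau (real n) s t) u *\<^sub>R x u) = - (LINT u|?M. plateau (real n) s t u *\<^sub>R g u)"
    if "n \<ge> N" for n
  proof -
    have "2 / (T - t) < real n"
      using N that by linarith
    moreover from this have "n > 0"
      using st by (smt (verit) divide_nonneg_pos of_nat_0_less_iff)
    moreover have "2 / real n < c" if "2 / c < real n" "0 < c" "0 < n" for c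
      using that by (simp add: field_simps)
    ultimately have "2 / real n < T - t"
      using st by simp
    then have "test_function T (plateau (real n) s t)"
      using st \<open>n > 0\<close> by (intro test_function_plateau) auto
    then show ?thesis
      using wd by (simp add: weak_derivative_def)
  qed
  then have "\<forall>\<^sub>F n in sequentially.
      (LINT u|?M. deriv (plateau (real n) s t) u *\<^sub>R x u) = - (LINT u|?M. plateau (real n) s t u *\<^sub>R g u)"
    by (auto simp: eventually_sequentially)
  with lim1 have "(\<lambda>n. - (LINT u|?M. plateau (real n) s t u *\<^sub>R g u)) \<longlonglongrightarrow> x s - x t"
    by (rule Lim_transform_eventually)
  with tendsto_minus[OF lim2] have "x s - x t = - (LINT u|?M. indicat_real {s<..t} u *\<^sub>R g u)"
    by (rule LIMSEQ_unique[rotated])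
  also have "(LINT u|?M. indicat_real {s<..t} u *\<^sub>R g u) = (LINT u|lebesgue_on {s..t}. g u)"
  proof -
    have "(LINT u|?M. indicat_real {s<..t} u *\<^sub>R g u) = (LINT u|?M. (if u \<in> {s..t} then g u else 0))"
    proof (rule integral_cong_AE)
      have [measurable]: "g \<in> borel_measurable ?M"
        using g by auto
      have [measurable]: "indicat_real {s<..t} \<in> borel_measurable ?M" "indicat_real {s..t} \<in> borel_measurable ?M"
        by (intro measurable_restrict_space1 borel_measurable_indicator; simp)+
      show "(\<lambda>u. indicat_real {s<..t} u *\<^sub>R g u) \<in> borel_measurable ?M"
        by measurable
      have "(\<lambda>u. indicat_real {s..t} u *\<^sub>R g u) \<in> borel_measurable ?M"
        by measurable
      then show "(\<lambda>u. if u \<in> {s..t} then g u else 0) \<in> borel_measurable ?M"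
        unfolding indicator_scaleR_eq_if .
      have "{s} \<in> null_sets lebesgue"
        by (simp add: negligible_iff_null_sets[symmetric])
      then have "AE u in lebesgue. u \<notin> {s}"
        by (rule AE_not_in)
      then have "AE u in ?M. u \<notin> {s}"
        by (subst AE_restrict_space_iff) (auto elim: eventually_mono)
      then show "AE u in ?M. indicat_real {s<..t} u *\<^sub>R g u = (if u \<in> {s..t} then g u else 0)"
        by eventually_elim (auto simp: indicator_def)
    qed
    also have "\<dots> = (LINT u|lebesgue_on ({s..t} \<inter> {0..T}). g u)"
      by (rule Lebesgue_Measure.integral_restrict_Int) auto
    finally show ?thesis
      using st by (simp add: Int_absorb2)
  qed
  also have "\<dots> = integral {s..t} g"
    using integrable_subinterval[OF g] st by (intro lebesgue_integral_eq_integral) auto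
  finally show ?thesis
    by (simp add: algebra_simps)
qed

text \<open>The difference of \<open>x\<close> and the primitive of \<open>g\<close> is constant on
  the open interval; continuity carries this to the endpoints.\<close>

lemma W12_integral_representation:
  fixes x :: "real \<Rightarrow> 'a::euclidean_space"
  assumes x: "x \<in> W12 T" and "T > 0"
  obtains g where "L2 T g" "weak_derivative T x g" "\<And>t. t \<in> {0..T} \<Longrightarrow> x t = x 0 + integral {0..t} g"
proof -
  obtain g where g: "L2 T g" "weak_derivative T x g" and ac: "abs_continuous_on {0..T} x"
    using x by (auto simp: W12_def)
  have cont: "continuous_on {0..T} x"
    using ac by (rule abs_continuous_on_imp_continuous_on)
  have int: "integrable (lebesgue_on {0..T}) g"
    using g(1) by (rule L2_integrable)
  have gi: "g integrable_on {0..T}"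
    by (rule integrable_on_subinterval_lebesgue_on[OF int]) auto
  define y where "y t = x t - integral {0..t} g" for t
  have conty: "continuous_on {0..T} y"
    unfolding y_def by (intro continuous_intros cont indefinite_integral_continuous_1 gi)
  have *: "y t = y s" if "0 < s" "s \<le> t" "t < T" for s t
    using weak_derivative_integral_interior[OF cont int g(2) that] indefinite_integral_diff[OF gi, of s t] that
    by (simp add: y_def algebra_simps)
  have "y t = y (T / 2)" if "t \<in> {0<..<T}" for t
    using *[of t "T / 2"] *[of "T / 2" t] that \<open>T > 0\<close> by (cases "t \<le> T / 2") auto
  then have "y constant_on {0<..<T}"
    unfolding constant_on_def by blast
  moreover have cl: "closure {0<..<T} = {0..T}"
    using \<open>T > 0\<close> by simp
  ultimately have "y constant_on {0..T}"
    using constant_on_closureI[of y "{0<..<T}"] conty by simp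
  then obtain c where c: "\<And>t. t \<in> {0..T} \<Longrightarrow> y t = c"
    unfolding constant_on_def by blast
  have "x t = x 0 + integral {0..t} g" if "t \<in> {0..T}" for t
  proof -
    have "y t = y 0"
      using c[OF that] c[of 0] \<open>T > 0\<close> by simp
    then show ?thesis
      by (simp add: y_def algebra_simps)
  qed
  with g show ?thesis
    by (rule that)
qed

section \<open>Classical derivatives of functions in \<open>W12\<close>\<close>

lemma AE_lebesgue_on_iff_negligible:
  "(AE t in lebesgue_on {a..b::real}. P t) \<longleftrightarrow> negligible {t \<in> {a..b}. \<not> P t}"
proof -
  have "(AE t in lebesgue_on {a..b}. P t) \<longleftrightarrow> (AE t in lebesgue. t \<in> {a..b} \<longrightarrow> P t)"
    by (rule AE_restrict_space_iff) auto
  also have "\<dots> \<longleftrightarrow> negligible {t \<in> {a..b}. \<not> P t}"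
    by (simp add: completion.AE_iff_null_sets negligible_iff_null_sets)
  finally show ?thesis .
qed

lemma AE_has_vector_derivative_indefinite_integral:
  fixes x g :: "real \<Rightarrow> 'a::euclidean_space"
  assumes g: "integrable (lebesgue_on {0..T}) g"
    and x: "\<And>t. t \<in> {0..T} \<Longrightarrow> x t = c + integral {0..t} g"
  shows "AE t in lebesgue_on {0..T}. (x has_vector_derivative g t) (at t within {0..T})"
proof -
  have gi: "g integrable_on {0..T}"
    by (rule integrable_on_subinterval_lebesgue_on[OF g]) auto
  have "(x has_vector_derivative g t) (at t within {0..T})"
    if "t \<in> {0..T}" "((\<lambda>t. integral {0..t} g) has_vector_derivative g t) (at t within {0..T})" for t
  proof -
    have "((\<lambda>t. c + integral {0..t} g) has_vector_derivative g t) (at t within {0..T})"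
      using that(2) has_vector_derivative_add[OF has_vector_derivative_const] by fastforce
    then show ?thesis
      by (rule has_vector_derivative_transform[rotated 2]) (use x that in auto)
  qed
  then show ?thesis
    unfolding AE_lebesgue_on_iff_negligible
    by (intro negligible_subset[OF indefinite_integral_has_vector_derivative_ae[OF gi]]) blast
qed

lemma vector_derivative_within_Icc:
  fixes x :: "real \<Rightarrow> 'a::real_normed_vector"
  assumes "t \<in> {0..T}" "T > 0" "(x has_vector_derivative v) (at t within {0..T})"
  shows "vector_derivative x (at t within {0..T}) = v"
  using vector_derivative_within_cbox[of 0 T t x v] assms by simp

text \<open>Completeness of Lebesgue measure gives measurability of \<open>g\<close> from
  \<open>f\<close>. This is how \<open>dot T x\<close> becomes measurable, its values at points of
  non-differentiability being arbitrary.\<close>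

lemma lebesgue_on_measurable_cong_AE:
  fixes f g :: "real \<Rightarrow> 'a::euclidean_space"
  assumes f: "f \<in> borel_measurable (lebesgue_on {0..T})"
    and "AE t in lebesgue_on {0..T}. g t = f t"
  shows "g \<in> borel_measurable (lebesgue_on {0..T})"
proof -
  have "(\<lambda>t. if t \<in> {0..T} then f t else 0) \<in> borel_measurable lebesgue"
    using f by (subst borel_measurable_if) auto
  moreover have "AE t in lebesgue. t \<in> {0..T} \<longrightarrow> g t = f t"
    using assms(2) by (subst (asm) AE_restrict_space_iff) auto
  then have "AE t in lebesgue. (if t \<in> {0..T} then f t else 0) = (if t \<in> {0..T} then g t else 0)"
    by (auto elim: eventually_mono)
  ultimately have "(\<lambda>t. if t \<in> {0..T} then g t else 0) \<in> borel_measurable lebesgue"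
    by (rule borel_measurable_AE)
  then show ?thesis
    by (subst (asm) borel_measurable_if) auto
qed

lemma weak_derivative_cong_AE:
  fixes x :: "real \<Rightarrow> 'a::euclidean_space"
  assumes wd: "weak_derivative T x g" and eq: "AE t in lebesgue_on {0..T}. h t = g t"
    and [measurable]: "g \<in> borel_measurable (lebesgue_on {0..T})" "h \<in> borel_measurable (lebesgue_on {0..T})"
  shows "weak_derivative T x h"
  unfolding weak_derivative_def
proof (intro allI impI)
  fix \<phi>
  assume \<phi>: "test_function T \<phi>"
  then have "continuous_on {0..T} \<phi>"
    unfolding test_function_def
    by (intro continuous_at_imp_continuous_on ballI differentiable_imp_continuous_within) blast
  then have [measurable]: "\<phi> \<in> borel_measurable (lebesgue_on {0..T})"
    by (intro continuous_imp_measurable_on_sets_lebesgue) auto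
  have "(LINT t|lebesgue_on {0..T}. \<phi> t *\<^sub>R g t) = (LINT t|lebesgue_on {0..T}. \<phi> t *\<^sub>R h t)"
    by (rule integral_cong_AE) (measurable, use eq in eventually_elim, simp)
  then show "(LINT t|lebesgue_on {0..T}. deriv \<phi> t *\<^sub>R x t) = - (LINT t|lebesgue_on {0..T}. \<phi> t *\<^sub>R h t)"
    using wd \<phi> by (simp add: weak_derivative_def)
qed

text \<open>From here on the classical derivative serves as the weak derivative: it differs from the
  one in the definition of \<open>W12\<close> on a null set only.\<close>

lemma W12_dot:
  fixes x :: "real \<Rightarrow> 'a::euclidean_space"
  assumes x: "x \<in> W12 T" and "T > 0"
  shows "L2 T (dot T x)" "weak_derivative T x (dot T x)" "\<And>t. t \<in> {0..T} \<Longrightarrow> x t = x 0 + integral {0..t} (dot T x)"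
    "AE t in lebesgue_on {0..T}. (x has_vector_derivative dot T x t) (at t within {0..T})"
proof -
  obtain g where g: "L2 T g" "weak_derivative T x g" "\<And>t. t \<in> {0..T} \<Longrightarrow> x t = x 0 + integral {0..t} g"
    by (rule W12_integral_representation[OF assms]) (rule that)
  have d: "AE t in lebesgue_on {0..T}. (x has_vector_derivative g t) (at t within {0..T})"
    using AE_has_vector_derivative_indefinite_integral[OF L2_integrable[OF g(1)] g(3)] .
  have "AE t in lebesgue_on {0..T}. t \<in> {0..T}"
    by (rule AE_I2) simp
  with d have eq: "AE t in lebesgue_on {0..T}. dot T x t = g t"
    by eventually_elim (rule vector_derivative_within_Icc[OF _ \<open>T > 0\<close>])
  show "AE t in lebesgue_on {0..T}. (x has_vector_derivative dot T x t) (at t within {0..T})"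
    using d eq by eventually_elim simp
  show L2: "L2 T (dot T x)"
    by (rule L2_cong_AE[OF g(1) lebesgue_on_measurable_cong_AE[OF _ eq] eq]) (use g(1) in \<open>simp add: L2_def\<close>)
  show "weak_derivative T x (dot T x)"
    by (rule weak_derivative_cong_AE[OF g(2) eq]) (use g(1) L2 in \<open>simp_all add: L2_def\<close>)
  show "x t = x 0 + integral {0..t} (dot T x)" if t: "t \<in> {0..T}" for t
  proof -
    have "negligible {t \<in> {0..T}. dot T x t \<noteq> g t}"
      using eq by (simp add: AE_lebesgue_on_iff_negligible)
    then have "integral {0..t} (dot T x) = integral {0..t} g"
      by (rule integral_spike[symmetric]) (use t in auto)
    then show ?thesis
      using g(3)[OF t] by simp
  qed
qed

section \<open>Midpoint hulls and weak limits\<close>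

text \<open>Finite convex combinations with dyadic weights. Closure under averages of two is what
  the parallelogram law uses, and it makes every preservation property a one-step induction.\<close>

inductive_set midhull :: "(real \<Rightarrow> 'a::real_vector) set \<Rightarrow> (real \<Rightarrow> 'a) set"
  for G :: "(real \<Rightarrow> 'a) set" where
  base: "u \<in> G \<Longrightarrow> u \<in> midhull G"
| midpoint: "u \<in> midhull G \<Longrightarrow> v \<in> midhull G \<Longrightarrow> (\<lambda>t. (1 / 2) *\<^sub>R (u t + v t)) \<in> midhull G"

lemma midhull_mono:
  assumes "u \<in> midhull G" "G \<subseteq> H"
  shows "u \<in> midhull H"
  using assms by (induction rule: midhull.induct) (auto intro: midhull.intros)

lemma midhull_L2:
  fixes G :: "(real \<Rightarrow> 'a::euclidean_space) set"
  assumes "u \<in> midhull G" "\<And>g. g \<in> G \<Longrightarrow> L2 T g"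
  shows "L2 T u"
  using assms by (induction rule: midhull.induct) (auto intro: L2_add L2_scaleR)

lemma midhull_pointwise:
  assumes "u \<in> midhull G" "convex C" "\<And>g. g \<in> G \<Longrightarrow> g t \<in> C"
  shows "u t \<in> C"
  using assms(1)
proof (induction rule: midhull.induct)
  case (midpoint u v)
  have "(1 / 2) *\<^sub>R u t + (1 / 2) *\<^sub>R v t \<in> C"
    using assms(2) midpoint by (intro convexD) auto
  then show ?case
    by (simp add: scaleR_add_right)
qed (rule assms(3))

text \<open>Pairing with \<psi> is linear, so it respects averages. Used with balls, to identify
  limits, and with half-lines, to keep pairings apart.\<close>

lemma midhull_inner_integral:
  fixes G :: "(real \<Rightarrow> 'a::euclidean_space) set"
  assumes "u \<in> midhull G" "\<And>g. g \<in> G \<Longrightarrow> L2 T g" "L2 T \<psi>" "convex C"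
    and "\<And>g. g \<in> G \<Longrightarrow> (LINT t|lebesgue_on {0..T}. g t \<bullet> \<psi> t) \<in> C"
  shows "(LINT t|lebesgue_on {0..T}. u t \<bullet> \<psi> t) \<in> C"
  using assms(1)
proof (induction rule: midhull.induct)
  case (midpoint u v)
  have "integrable (lebesgue_on {0..T}) (\<lambda>t. u t \<bullet> \<psi> t)" "integrable (lebesgue_on {0..T}) (\<lambda>t. v t \<bullet> \<psi> t)"
    using midpoint midhull_L2[OF _ assms(2)] assms(3) by (auto intro: L2_inner_integrable)
  then have "(LINT t|lebesgue_on {0..T}. ((1 / 2) *\<^sub>R (u t + v t)) \<bullet> \<psi> t)
      = (1 / 2) *\<^sub>R (LINT t|lebesgue_on {0..T}. u t \<bullet> \<psi> t)
        + (1 / 2) *\<^sub>R (LINT t|lebesgue_on {0..T}. v t \<bullet> \<psi> t)"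
    by (simp add: inner_add_left add_divide_distrib)
  also have "\<dots> \<in> C"
    using assms(4) midpoint by (intro convexD) auto
  finally show ?case .
qed (rule assms(5))

section \<open>Near-minimisers of the energy and their limits\<close>

definition energy :: "real \<Rightarrow> (real \<Rightarrow> 'a::euclidean_space) \<Rightarrow> real" where
  "energy T u = (LINT t|lebesgue_on {0..T}. (norm (u t))\<^sup>2)"

lemma energy_nonneg: "0 \<le> energy T u"
  unfolding energy_def by (rule Bochner_Integration.integral_nonneg) simp

lemma energy_parallelogram:
  fixes u v :: "real \<Rightarrow> 'a::euclidean_space"
  assumes "L2 T u" "L2 T v"
  shows "energy T (\<lambda>t. u t - v t)
    = 2 * energy T u + 2 * energy T v - 4 * energy T (\<lambda>t. (1 / 2) *\<^sub>R (u t + v t))"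
proof -
  have int: "integrable (lebesgue_on {0..T}) (\<lambda>t. (norm (u t))\<^sup>2)"
    "integrable (lebesgue_on {0..T}) (\<lambda>t. (norm (v t))\<^sup>2)"
    "integrable (lebesgue_on {0..T}) (\<lambda>t. (norm ((1 / 2) *\<^sub>R (u t + v t)))\<^sup>2)"
    using assms L2_scaleR[OF L2_add[OF assms], of "1 / 2"] unfolding L2_def by blast+
  have "(norm (u t - v t))\<^sup>2
      = 2 * (norm (u t))\<^sup>2 + 2 * (norm (v t))\<^sup>2 - 4 * (norm ((1 / 2) *\<^sub>R (u t + v t)))\<^sup>2" for t
    by (simp add: power_divide power2_norm_eq_inner inner_simps inner_commute field_simps)
  then have "energy T (\<lambda>t. u t - v t) = (LINT t|lebesgue_on {0..T}.
      2 * (norm (u t))\<^sup>2 + 2 * (norm (v t))\<^sup>2 - 4 * (norm ((1 / 2) *\<^sub>R (u t + v t)))\<^sup>2)"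
    unfolding energy_def by simp
  also have "\<dots> = 2 * energy T u + 2 * energy T v - 4 * energy T (\<lambda>t. (1 / 2) *\<^sub>R (u t + v t))"
    unfolding energy_def using int
    by (simp only: Bochner_Integration.integral_diff Bochner_Integration.integral_add
        integral_mult_right_zero integrable_mult_right Bochner_Integration.integrable_add)
  finally show ?thesis .
qed

text \<open>The infima of the energy over the midpoint hulls of the tails increase to a finite limit, so
  the parallelogram law makes near-minimisers Cauchy; this replaces weak compactness of balls.\<close>

lemma midhull_near_minimisers:
  fixes g :: "nat \<Rightarrow> real \<Rightarrow> 'a::euclidean_space"
  assumes g: "\<And>n. L2 T (g n)" and K: "\<And>n. energy T (g n) \<le> K"
    and e: "\<And>n. e n > 0" "\<And>n. e (Suc n) \<le> e n"
  obtains u where "\<And>n. u n \<in> midhull (g ` {n..})"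
    "\<And>n. energy T (\<lambda>t. u (Suc n) t - u n t) \<le> 6 * e n"
proof -
  define H where "H n = midhull (g ` {n..})" for n
  have Hmono: "H n \<subseteq> H m" if "m \<le> n" for m n
    unfolding H_def using that by (auto elim!: midhull_mono)
  have HL2: "L2 T u" if "u \<in> H n" for u n
    using that midhull_L2[of u "g ` {n..}"] g by (auto simp: H_def)
  have gH: "g n \<in> H n" for n
    by (auto simp: H_def intro: midhull.base)
  define \<rho> where "\<rho> n = (INF u\<in>H n. energy T u)" for n
  have bdd: "bdd_below (energy T ` H n)" for n
    by (rule bdd_belowI[of _ 0]) (auto simp: energy_nonneg)
  have \<rho>_le: "\<rho> n \<le> energy T u" if "u \<in> H n" for u n
    unfolding \<rho>_def using bdd that by (rule cINF_lower)
  have "\<rho> m \<le> \<rho> n" if "m \<le> n" for m n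
    unfolding \<rho>_def using gH Hmono[OF that] bdd by (intro cINF_superset_mono) auto
  then have inc: "incseq \<rho>"
    by (simp add: incseq_def)
  have "\<rho> n \<le> K" for n
    using \<rho>_le[OF gH] K order_trans by blast
  then obtain r where lim: "\<rho> \<longlonglongrightarrow> r" and r: "\<And>n. \<rho> n \<le> r"
    using incseq_convergent[OF inc] by blast
  have "\<exists>M. \<forall>n\<ge>M. r - \<rho> n < e k" for k
  proof -
    have "\<forall>\<^sub>F n in sequentially. r - e k < \<rho> n"
      using e(1)[of k] by (intro order_tendstoD(1)[OF lim]) simp
    then show ?thesis
      unfolding eventually_sequentially by (simp add: algebra_simps)
  qed
  then obtain M where M: "\<And>k n. n \<ge> M k \<Longrightarrow> r - \<rho> n < e k"
    by metis
  \<comment> \<open>Adding all earlier thresholds makes \<open>N\<close> increasing, hence the hulls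
    nested; the summand \<open>n\<close> keeps \<open>u n\<close> in the hull of the tail from
    \<open>n\<close>.\<close>
  define N where "N n = n + (\<Sum>i\<le>n. M i)" for n
  have "M n \<le> N n" for n
    unfolding N_def by (rule trans_le_add2) (auto intro: member_le_sum)
  then have near: "r - \<rho> (N n) < e n" for n
    using M by blast
  have "\<exists>u\<in>H (N n). energy T u < \<rho> (N n) + e n" for n
  proof (rule ccontr)
    assume "\<not> ?thesis"
    then have "\<rho> (N n) + e n \<le> \<rho> (N n)"
      unfolding \<rho>_def[of "N n"] using gH by (intro cINF_greatest) (auto simp: not_less \<rho>_def)
    with e(1)[of n] show False
      by simp
  qed
  then obtain u where u: "\<And>n. u n \<in> H (N n)" "\<And>n. energy T (u n) < \<rho> (N n) + e n"
    by metis
  show ?thesis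
  proof
    show "u n \<in> midhull (g ` {n..})" for n
      using u(1)[of n] Hmono[of n "N n"] by (auto simp: N_def H_def)
    show "energy T (\<lambda>t. u (Suc n) t - u n t) \<le> 6 * e n" for n
    proof -
      have "u (Suc n) \<in> H (N n)"
        using u(1)[of "Suc n"] Hmono[of "N n" "N (Suc n)"] by (auto simp: N_def)
      then have "(\<lambda>t. (1 / 2) *\<^sub>R (u (Suc n) t + u n t)) \<in> H (N n)"
        using u(1)[of n] unfolding H_def by (intro midhull.midpoint)
      then have "\<rho> (N n) \<le> energy T (\<lambda>t. (1 / 2) *\<^sub>R (u (Suc n) t + u n t))"
        by (rule \<rho>_le)
      \<comment> \<open>The parallelogram law leaves at most 2(\<rho>(N(n+1)) - \<rho>(N n)) + 2
        e(n+1) + 2 e(n); the difference of infima is below e(n) and e(n+1) is at most e(n), hence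
        the 6.\<close>
      then show ?thesis
        unfolding energy_parallelogram[OF HL2[OF u(1)] HL2[OF u(1)]]
        using u(2)[of n] u(2)[of "Suc n"] r[of "N (Suc n)"] near[of n] e(2)[of n] by linarith
    qed
  qed
qed

text \<open>Cauchy-Schwarz with weights 2^-k and 2^k; the factor 2 is the sum of the geometric
  series.\<close>

lemma power2_sum_le_weighted:
  fixes a :: "nat \<Rightarrow> real"
  shows "(\<Sum>k<n. a k)\<^sup>2 \<le> 2 * (\<Sum>k<n. 2 ^ k * (a k)\<^sup>2)"
proof -
  have sq: "(sqrt (1 / 2) ^ k)\<^sup>2 = (1 / 2) ^ k" "(sqrt 2 ^ k)\<^sup>2 = 2 ^ k" for k
    by (simp_all add: power_mult[symmetric] mult.commute[of k] power_mult real_sqrt_divide power_divide)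
  have eq: "sqrt (1 / 2) ^ k * (sqrt 2 ^ k * a k) = a k" for k
    by (simp add: real_sqrt_divide power_divide)
  have "(\<Sum>k<n. a k)\<^sup>2 = (\<Sum>k<n. sqrt (1 / 2) ^ k * (sqrt 2 ^ k * a k))\<^sup>2"
    by (simp only: eq)
  also have "\<dots> \<le> (\<Sum>k<n. (sqrt (1 / 2) ^ k)\<^sup>2) * (\<Sum>k<n. (sqrt 2 ^ k * a k)\<^sup>2)"
    by (rule Cauchy_Schwarz_ineq_sum)
  also have "\<dots> = (\<Sum>k<n. (1 / 2) ^ k) * (\<Sum>k<n. 2 ^ k * (a k)\<^sup>2)"
    by (simp only: sq power_mult_distrib)
  also have "\<dots> \<le> 2 * (\<Sum>k<n. 2 ^ k * (a k)\<^sup>2)"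
  proof (rule mult_right_mono)
    show "(\<Sum>k<n. (1 / 2) ^ k) \<le> (2 :: real)"
      by (simp add: geometric_sum)
  qed (auto intro: sum_nonneg)
  finally show ?thesis .
qed

text \<open>The integral of the sum is the sum of the integrals, hence finite, so the sum is finite
  almost everywhere. It serves both for increments of near-minimisers and for squared distances to
  the values of F.\<close>

lemma AE_summable_of_summable_integrals:
  fixes q :: "nat \<Rightarrow> 'b \<Rightarrow> real"
  assumes int: "\<And>k. integrable M (q k)" and nonneg: "\<And>k t. 0 \<le> q k t"
    and le: "\<And>k. (LINT t|M. q k t) \<le> r k" and r: "summable r"
  shows "AE t in M. summable (\<lambda>k. q k t)"
proof -
  have sum_int: "summable (\<lambda>k. LINT t|M. q k t)"
    by (rule summable_comparison_test'[OF r, where N = 0])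
       (use le nonneg in \<open>auto simp: Bochner_Integration.integral_nonneg\<close>)
  have "(\<integral>\<^sup>+t. (\<Sum>k. ennreal (q k t)) \<partial>M) = (\<Sum>k. \<integral>\<^sup>+t. ennreal (q k t) \<partial>M)"
    using int by (intro nn_integral_suminf) auto
  also have "\<dots> = (\<Sum>k. ennreal (LINT t|M. q k t))"
    using int nonneg by (intro suminf_cong nn_integral_eq_integral) auto
  also have "\<dots> = ennreal (\<Sum>k. LINT t|M. q k t)"
    using sum_int nonneg by (intro suminf_ennreal2) (auto intro: Bochner_Integration.integral_nonneg)
  finally have "(\<integral>\<^sup>+t. (\<Sum>k. ennreal (q k t)) \<partial>M) \<noteq> \<infinity>"
    by simp
  then have "AE t in M. (\<Sum>k. ennreal (q k t)) \<noteq> \<infinity>"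
    using int by (intro nn_integral_PInf_AE) auto
  then show ?thesis
    by eventually_elim (use nonneg in \<open>auto intro: summable_suminf_not_top\<close>)
qed

text \<open>The rate 4^-n leaves room for a weight 2^k on the squared increments. The weighted
  series still has a finite integral, and it controls both the a.e. convergence and an integrable
  majorant of all \<open>(norm (u n t))\<^sup>2\<close>, so the pairings converge by
  domination.\<close>

lemma L2_rapidly_Cauchy_limit:
  fixes u :: "nat \<Rightarrow> real \<Rightarrow> 'a::euclidean_space"
  assumes u: "\<And>n. L2 T (u n)" and fast: "\<And>n. energy T (\<lambda>t. u (Suc n) t - u n t) \<le> 6 * (1 / 4) ^ n"
  obtains f where "L2 T f" "AE t in lebesgue_on {0..T}. (\<lambda>n. u n t) \<longlonglongrightarrow> f t"
    "\<And>\<psi>. L2 T \<psi> \<Longrightarrow> (\<lambda>n. LINT t|lebesgue_on {0..T}. u n t \<bullet> \<psi> t)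
      \<longlonglongrightarrow> (LINT t|lebesgue_on {0..T}. f t \<bullet> \<psi> t)"
proof -
  let ?M = "lebesgue_on {0..T}"
  have [measurable]: "u n \<in> borel_measurable ?M" for n
    using u by (simp add: L2_def)
  define q where "q k t = 2 ^ k * (norm (u (Suc k) t - u k t))\<^sup>2" for k t
  have q_nonneg: "0 \<le> q k t" for k t
    by (simp add: q_def)
  have q_int: "integrable ?M (q k)" for k
    using L2_diff[OF u u, of "Suc k" k] unfolding q_def L2_def by auto
  have q_le: "(LINT t|?M. q k t) \<le> 6 * (1 / 2) ^ k" for k
  proof -
    have "(LINT t|?M. q k t) = 2 ^ k * energy T (\<lambda>t. u (Suc k) t - u k t)"
      by (simp add: q_def energy_def)
    also have "\<dots> \<le> 2 ^ k * (6 * (1 / 4) ^ k)"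
      using fast by (intro mult_left_mono) auto
    also have "\<dots> = 6 * (1 / 2) ^ k"
      by (simp add: power_mult_distrib[symmetric])
    finally show ?thesis .
  qed
  have sum_geo: "summable (\<lambda>k. 6 * (1 / 2 :: real) ^ k)"
    by (intro summable_mult summable_geometric) simp
  have sum_int: "summable (\<lambda>k. LINT t|?M. q k t)"
    by (rule summable_comparison_test'[OF sum_geo, where N = 0])
       (use q_le q_nonneg in \<open>auto simp: Bochner_Integration.integral_nonneg\<close>)
  have ae: "AE t in ?M. summable (\<lambda>k. q k t)"
    by (rule AE_summable_of_summable_integrals[OF q_int q_nonneg q_le sum_geo])
  define Q where "Q t = (\<Sum>k. q k t)" for t
  have Q_int: "integrable ?M Q"
    unfolding Q_def using q_int ae sum_int q_nonneg by (intro integrable_suminf) auto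
  have tele: "u n t = u 0 t + (\<Sum>k<n. u (Suc k) t - u k t)" for n t
    using sum_lessThan_telescope[of "\<lambda>k. u k t" n] by simp
  \<comment> \<open>Twice the square of the first term plus twice the square of the telescoping sum,
    the latter square being at most \<open>2 * Q t\<close>.\<close>
  define W where "W t = 2 * (norm (u 0 t))\<^sup>2 + 4 * Q t" for t
  have W_int: "integrable ?M W"
    unfolding W_def using Q_int u[of 0] by (auto simp: L2_def)
  have bound: "(norm (u n t))\<^sup>2 \<le> W t" if "summable (\<lambda>k. q k t)" for n t
  proof -
    have "norm (\<Sum>k<n. u (Suc k) t - u k t) \<le> (\<Sum>k<n. norm (u (Suc k) t - u k t))"
      by (rule norm_sum)
    then have "(norm (\<Sum>k<n. u (Suc k) t - u k t))\<^sup>2 \<le> (\<Sum>k<n. norm (u (Suc k) t - u k t))\<^sup>2"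
      by (intro power_mono) auto
    also have "\<dots> \<le> 2 * (\<Sum>k<n. q k t)"
      unfolding q_def by (rule power2_sum_le_weighted)
    also have "\<dots> \<le> 2 * Q t"
      unfolding Q_def using that q_nonneg by (intro mult_left_mono sum_le_suminf) auto
    finally show ?thesis
      unfolding W_def tele[of n] using norm_add_power2_le[of "u 0 t" "\<Sum>k<n. u (Suc k) t - u k t"] by linarith
  qed
  have conv: "convergent (\<lambda>n. u n t)" if "summable (\<lambda>k. q k t)" for t
  proof -
    \<comment> \<open>Young's inequality with weight 2^k: it bounds the increments themselves by a
      summable series, so they converge absolutely.\<close>
    have le: "norm (u (Suc k) t - u k t) \<le> (1 / 2) ^ k + q k t" for k
    proof -
      define a where "a = norm (u (Suc k) t - u k t)"
      have "0 \<le> (2 ^ k * a - 1)\<^sup>2 / 2 ^ k + a"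
        by (simp add: a_def)
      also have "\<dots> = (1 / 2) ^ k + 2 ^ k * a\<^sup>2 - a"
        by (simp add: field_simps power2_eq_square)
      finally show ?thesis
        unfolding q_def a_def by simp
    qed
    have "summable (\<lambda>k. (1 / 2) ^ k + q k t)"
      using that by (intro summable_add summable_geometric) auto
    then have "summable (\<lambda>k. norm (u (Suc k) t - u k t))"
      by (rule summable_comparison_test'[where N = 0]) (use le in auto)
    then have "summable (\<lambda>k. u (Suc k) t - u k t)"
      by (rule summable_norm_cancel)
    then have "convergent (\<lambda>n. u 0 t + (\<Sum>k<n. u (Suc k) t - u k t))"
      unfolding summable_iff_convergent by (intro convergent_add convergent_const)
    then show ?thesis
      unfolding tele[symmetric] .
  qed
  define f where "f t = lim (\<lambda>n. u n t)" for t
  have f_meas [measurable]: "f \<in> borel_measurable ?M"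
    unfolding f_def by measurable
  have lim: "AE t in ?M. (\<lambda>n. u n t) \<longlonglongrightarrow> f t"
    using ae by eventually_elim (use conv in \<open>auto simp: f_def convergent_LIMSEQ_iff\<close>)
  have "AE t in ?M. (norm (f t))\<^sup>2 \<le> W t"
    using ae lim
  proof eventually_elim
    case (elim t)
    then have "(\<lambda>n. (norm (u n t))\<^sup>2) \<longlonglongrightarrow> (norm (f t))\<^sup>2"
      by (intro tendsto_power tendsto_norm)
    then show ?case
      by (rule LIMSEQ_le_const2) (use bound elim in auto)
  qed
  then have f_L2: "L2 T f"
    by (rule L2_bounded_by[OF f_meas W_int])
  show ?thesis
  proof (rule that[OF f_L2 lim])
    fix \<psi> :: "real \<Rightarrow> 'a"
    assume \<psi>: "L2 T \<psi>"
    then have [measurable]: "\<psi> \<in> borel_measurable ?M"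
      by (simp add: L2_def)
    show "(\<lambda>n. LINT t|?M. u n t \<bullet> \<psi> t) \<longlonglongrightarrow> (LINT t|?M. f t \<bullet> \<psi> t)"
    proof (rule integral_dominated_convergence)
      show "integrable ?M (\<lambda>t. W t + (norm (\<psi> t))\<^sup>2)"
        using W_int \<psi> by (auto simp: L2_def)
      show "AE t in ?M. (\<lambda>n. u n t \<bullet> \<psi> t) \<longlonglongrightarrow> f t \<bullet> \<psi> t"
        using lim by eventually_elim (intro tendsto_inner tendsto_const)
      show "AE t in ?M. norm (u n t \<bullet> \<psi> t) \<le> W t + (norm (\<psi> t))\<^sup>2" for n
        using ae
      proof eventually_elim
        case (elim t)
        then show ?case
          using abs_inner_le_power2[of "u n t" "\<psi> t"] bound[of t n] by simp
      qed
    qed measurable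
  qed
qed

lemma midhull_limit:
  fixes g :: "nat \<Rightarrow> real \<Rightarrow> 'a::euclidean_space"
  assumes g: "\<And>n. L2 T (g n)" and K: "\<And>n. energy T (g n) \<le> K"
  obtains h f where "\<And>n. h n \<in> midhull (g ` {n..})" "L2 T f"
    "AE t in lebesgue_on {0..T}. (\<lambda>n. h n t) \<longlonglongrightarrow> f t"
    "\<And>\<psi>. L2 T \<psi> \<Longrightarrow> (\<lambda>n. LINT t|lebesgue_on {0..T}. h n t \<bullet> \<psi> t)
      \<longlonglongrightarrow> (LINT t|lebesgue_on {0..T}. f t \<bullet> \<psi> t)"
proof -
  obtain h where h: "\<And>n. h n \<in> midhull (g ` {n..})"
      "\<And>n. energy T (\<lambda>t. h (Suc n) t - h n t) \<le> 6 * (1 / 4) ^ n"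
    by (rule midhull_near_minimisers[of T g K "\<lambda>n. (1 / 4) ^ n"]) (use g K in auto)
  have "L2 T (h n)" for n
    using midhull_L2[OF h(1)] g by blast
  then show ?thesis
    by (rule L2_rapidly_Cauchy_limit[OF _ h(2)]) (rule that[OF h(1)])
qed

text \<open>Pairing with the indicator of [0, t] times a basis vector gives a coordinate of the
  primitive at t. For the tails of \<open>g\<close> these numbers lie in small balls around the
  coordinate of \<open>y t\<close>; balls are convex, so the averages stay there and have the same
  limit.\<close>

lemma midhull_limit_of_indefinite_integrals:
  fixes g :: "nat \<Rightarrow> real \<Rightarrow> 'a::euclidean_space"
  assumes g: "\<And>n. L2 T (g n)" and K: "\<And>n. energy T (g n) \<le> K"
    and y: "\<And>t. t \<in> {0..T} \<Longrightarrow> (\<lambda>n. integral {0..t} (g n)) \<longlonglongrightarrow> y t"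
  obtains h f where "\<And>n. h n \<in> midhull (g ` {n..})" "L2 T f"
    "AE t in lebesgue_on {0..T}. (\<lambda>n. h n t) \<longlonglongrightarrow> f t"
    "\<And>\<psi>. L2 T \<psi> \<Longrightarrow> (\<lambda>n. LINT t|lebesgue_on {0..T}. h n t \<bullet> \<psi> t)
      \<longlonglongrightarrow> (LINT t|lebesgue_on {0..T}. f t \<bullet> \<psi> t)"
    "\<And>t. t \<in> {0..T} \<Longrightarrow> y t = integral {0..t} f"
proof -
  let ?M = "lebesgue_on {0..T}"
  obtain h f where h: "\<And>n. h n \<in> midhull (g ` {n..})" and f: "L2 T f"
    "AE t in ?M. (\<lambda>n. h n t) \<longlonglongrightarrow> f t"
    and weak: "\<And>\<psi>. L2 T \<psi> \<Longrightarrow> (\<lambda>n. LINT t|?M. h n t \<bullet> \<psi> t) \<longlonglongrightarrow> (LINT t|?M. f t \<bullet> \<psi> t)"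
    by (rule midhull_limit[of T g K, OF g K]) (rule that)
  have hL2: "L2 T (h n)" for n
    using midhull_L2[OF h] g by blast
  have "y t = integral {0..t} f" if t: "t \<in> {0..T}" for t
  proof (rule euclidean_eqI)
    fix b :: 'a
    define \<psi> where "\<psi> u = indicat_real {0..t} u *\<^sub>R b" for u
    have [measurable]: "indicat_real {0..t} \<in> borel_measurable ?M"
      by (intro measurable_restrict_space1 borel_measurable_indicator) simp
    have \<psi>: "L2 T \<psi>"
    proof (rule L2_bounded)
      show "\<psi> \<in> borel_measurable ?M"
        unfolding \<psi>_def by measurable
      show "norm (\<psi> u) \<le> norm b" for u
        by (simp add: \<psi>_def indicator_def)
    qed
    have eq: "(LINT u|?M. w u \<bullet> \<psi> u) = integral {0..t} w \<bullet> b" if w: "L2 T w" for w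
    proof -
      have int: "integrable (lebesgue_on {0..t}) w"
        using integrable_subinterval[OF L2_integrable[OF w], of 0 t] t by auto
      have "(LINT u|?M. w u \<bullet> \<psi> u) = (LINT u|?M. (if u \<in> {0..t} then w u \<bullet> b else 0))"
        unfolding \<psi>_def by (intro Bochner_Integration.integral_cong) (auto simp: indicator_def)
      also have "\<dots> = (LINT u|lebesgue_on ({0..t} \<inter> {0..T}). w u \<bullet> b)"
        by (rule Lebesgue_Measure.integral_restrict_Int) auto
      also have "{0..t} \<inter> {0..T} = {0..t}"
        using t by auto
      also have "(LINT u|lebesgue_on {0..t}. w u \<bullet> b) = (LINT u|lebesgue_on {0..t}. w u) \<bullet> b"
        using int by (rule integral_inner_left)
      also have "(LINT u|lebesgue_on {0..t}. w u) = integral {0..t} w"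
        using int by (intro lebesgue_integral_eq_integral) auto
      finally show ?thesis .
    qed
    have "(\<lambda>n. integral {0..t} (h n) \<bullet> b) \<longlonglongrightarrow> integral {0..t} f \<bullet> b"
      using weak[OF \<psi>] by (simp add: eq f(1) hL2)
    moreover have "(\<lambda>n. integral {0..t} (h n) \<bullet> b) \<longlonglongrightarrow> y t \<bullet> b"
      unfolding LIMSEQ_def
    proof (intro allI impI)
      fix e :: real
      assume "e > 0"
      have "(\<lambda>n. integral {0..t} (g n) \<bullet> b) \<longlonglongrightarrow> y t \<bullet> b"
        by (intro tendsto_inner y t tendsto_const)
      then obtain N where N: "\<And>n. n \<ge> N \<Longrightarrow> integral {0..t} (g n) \<bullet> b \<in> ball (y t \<bullet> b) e"
        using \<open>e > 0\<close> by (force simp: LIMSEQ_def dist_commute)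
      have "integral {0..t} (h n) \<bullet> b \<in> ball (y t \<bullet> b) e" if "n \<ge> N" for n
      proof -
        have "(LINT u|?M. h n u \<bullet> \<psi> u) \<in> ball (y t \<bullet> b) e"
          using N g eq that by (intro midhull_inner_integral[OF h[of n] _ \<psi>]) auto
        then show ?thesis
          by (simp add: eq hL2)
      qed
      then show "\<exists>N. \<forall>n\<ge>N. dist (integral {0..t} (h n) \<bullet> b) (y t \<bullet> b) < e"
        by (auto simp: dist_commute)
    qed
    ultimately show "y t \<bullet> b = integral {0..t} f \<bullet> b"
      by (rule LIMSEQ_unique[rotated])
  qed
  with h f weak show ?thesis
    by (rule that)
qed

section \<open>From convergence of primitives to weak convergence in L2\<close>

lemma indefinite_integral_eq_AE:
  fixes f g :: "real \<Rightarrow> 'a::euclidean_space"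
  assumes "T > 0" "L2 T f" "L2 T g"
    and eq: "\<And>t. t \<in> {0..T} \<Longrightarrow> integral {0..t} f = integral {0..t} g"
  shows "AE t in lebesgue_on {0..T}. f t = g t"
proof -
  have "AE t in lebesgue_on {0..T}.
      ((\<lambda>t. integral {0..t} f) has_vector_derivative f t) (at t within {0..T})"
    by (rule AE_has_vector_derivative_indefinite_integral[OF L2_integrable[OF assms(2)], where c = 0]) simp
  moreover have "AE t in lebesgue_on {0..T}.
      ((\<lambda>t. integral {0..t} f) has_vector_derivative g t) (at t within {0..T})"
    by (rule AE_has_vector_derivative_indefinite_integral[OF L2_integrable[OF assms(3)], where c = 0])
       (simp add: eq)
  moreover have "AE t in lebesgue_on {0..T}. t \<in> {0..T}"
    by (rule AE_I2) simp
  ultimately show ?thesis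
  proof eventually_elim
    case (elim t)
    then show ?case
      using vector_derivative_within_Icc[OF _ \<open>T > 0\<close>] by metis
  qed
qed

text \<open>Uniqueness of the limit avoids the density of step functions: if the pairing with some
  \<open>\<psi>\<close> stayed away from its expected limit along a subsequence, midpoint combinations of that
  subsequence would have a limit with the same primitive but another pairing with \<open>\<psi>\<close>.\<close>

lemma weakly_tendsto_L2_of_indefinite_integrals:
  fixes g :: "nat \<Rightarrow> real \<Rightarrow> 'a::euclidean_space"
  assumes "T > 0" and g: "\<And>n. L2 T (g n)" and K: "\<And>n. energy T (g n) \<le> K"
    and f: "L2 T f"
    and y: "\<And>t. t \<in> {0..T} \<Longrightarrow> (\<lambda>n. integral {0..t} (g n)) \<longlonglongrightarrow> integral {0..t} f"
  shows "weakly_tendsto_L2 T g f"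
proof -
  let ?M = "lebesgue_on {0..T}"
  let ?I = "\<lambda>w \<psi>. LINT t|?M. w t \<bullet> \<psi> t"
  \<comment> \<open>One-sided, because a half-line is convex while the complement of a ball is not:
    pairings that stay above a level do so after averaging. Replacing \<psi> by its negative gives
    the other side.\<close>
  have upper: "\<forall>\<^sub>F n in sequentially. ?I (g n) \<psi> < ?I f \<psi> + e" if \<psi>: "L2 T \<psi>" and "e > 0" for \<psi> e
  proof (rule ccontr)
    assume "\<not> ?thesis"
    then have "\<exists>n\<ge>Suc N. \<not> ?I (g n) \<psi> < ?I f \<psi> + e" for N
      unfolding eventually_sequentially by blast
    then have "\<exists>n>N. ?I f \<psi> + e \<le> ?I (g n) \<psi>" for N
      unfolding not_less Suc_le_eq .
    then have "infinite {n. ?I f \<psi> + e \<le> ?I (g n) \<psi>}"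
      unfolding infinite_nat_iff_unbounded by simp
    then obtain r :: "nat \<Rightarrow> nat" where r: "strict_mono r" "\<And>n. ?I f \<psi> + e \<le> ?I (g (r n)) \<psi>"
      using infinite_enumerate[of "{n. ?I f \<psi> + e \<le> ?I (g n) \<psi>}"] by auto
    have lim: "(\<lambda>n. integral {0..t} (g (r n))) \<longlonglongrightarrow> integral {0..t} f" if "t \<in> {0..T}" for t
      using LIMSEQ_subseq_LIMSEQ[OF y[OF that] r(1)] by (simp add: o_def)
    obtain h f' where h: "\<And>n. h n \<in> midhull ((\<lambda>n. g (r n)) ` {n..})" and f': "L2 T f'"
      "AE t in lebesgue_on {0..T}. (\<lambda>n. h n t) \<longlonglongrightarrow> f' t"
      and weak: "\<And>\<psi>. L2 T \<psi> \<Longrightarrow> (\<lambda>n. ?I (h n) \<psi>) \<longlonglongrightarrow> ?I f' \<psi>"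
      and prim: "\<And>t. t \<in> {0..T} \<Longrightarrow> integral {0..t} f = integral {0..t} f'"
      by (rule midhull_limit_of_indefinite_integrals[of T "\<lambda>n. g (r n)" K, OF g K lim]) (assumption, rule that)
    have "?I f \<psi> + e \<le> ?I (h n) \<psi>" for n
      using midhull_inner_integral[OF h[of n] _ \<psi>, of "{?I f \<psi> + e..}"] g r(2) by auto
    then have "?I f \<psi> + e \<le> ?I f' \<psi>"
      by (intro LIMSEQ_le_const[OF weak[OF \<psi>]]) auto
    moreover have "?I f \<psi> = ?I f' \<psi>"
    proof (rule Bochner_Integration.integral_cong_AE)
      have "AE t in ?M. f t = f' t"
        by (rule indefinite_integral_eq_AE[OF \<open>T > 0\<close> f f'(1)]) (rule prim)
      then show "AE t in ?M. f t \<bullet> \<psi> t = f' t \<bullet> \<psi> t"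
        by eventually_elim simp
    qed (use f f' \<psi> in \<open>auto simp: L2_def intro!: borel_measurable_inner\<close>)
    ultimately show False
      using \<open>e > 0\<close> by simp
  qed
  have "(\<lambda>n. ?I (g n) \<psi>) \<longlonglongrightarrow> ?I f \<psi>" if \<psi>: "L2 T \<psi>" for \<psi>
    unfolding tendsto_iff
  proof (intro allI impI)
    fix e :: real
    assume "e > 0"
    have "L2 T (\<lambda>t. - \<psi> t)"
      using L2_scaleR[OF \<psi>, of "-1"] by simp
    from upper[OF \<psi> \<open>e > 0\<close>] upper[OF this \<open>e > 0\<close>]
    show "\<forall>\<^sub>F n in sequentially. dist (?I (g n) \<psi>) (?I f \<psi>) < e"
      by eventually_elim (simp add: dist_real_def abs_less_iff)
  qed
  with g f show ?thesis
    unfolding weakly_tendsto_L2_def by blast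
qed

text \<open>The identity defining the weak derivative is passed to the limit, the side with
  \<open>x n\<close> by uniform convergence and the side with the derivatives by weak
  convergence.\<close>

lemma W12_indefinite_integral_limit:
  fixes x :: "nat \<Rightarrow> real \<Rightarrow> 'a::euclidean_space"
  assumes "T > 0" and x: "\<And>n. x n \<in> W12 T" and f: "L2 T f"
    and unif: "uniform_limit {0..T} x y sequentially"
    and y: "\<And>t. t \<in> {0..T} \<Longrightarrow> y t = y 0 + integral {0..t} f"
    and weak: "weakly_tendsto_L2 T (\<lambda>n. dot T (x n)) f"
  shows "y \<in> W12 T"
proof -
  let ?M = "lebesgue_on {0..T}"
  have ac: "abs_continuous_on {0..T} y"
    by (rule abs_continuous_on_indefinite_integral[OF f y])
  have conty: "continuous_on {0..T} y"
    by (rule abs_continuous_on_imp_continuous_on[OF ac])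
  have contx: "continuous_on {0..T} (x n)" for n
    using x[of n] by (auto simp: W12_def intro: abs_continuous_on_imp_continuous_on)
  have "weak_derivative T y f"
    unfolding weak_derivative_def
  proof (intro allI impI)
    fix \<phi>
    assume \<phi>: "test_function T \<phi>"
    then have cont: "continuous_on {0..T} \<phi>" "continuous_on {0..T} (deriv \<phi>)"
      unfolding test_function_def
      by (auto intro: continuous_on_subset differentiable_imp_continuous_within continuous_at_imp_continuous_on)
    have eq: "(LINT t|?M. deriv \<phi> t *\<^sub>R y t) \<bullet> b = - (LINT t|?M. \<phi> t *\<^sub>R f t) \<bullet> b" for b
    proof -
      have L2b: "L2 T (\<lambda>t. c t *\<^sub>R b)" if "continuous_on {0..T} c" for c
        using that by (intro L2_continuous continuous_intros)
      \<comment> \<open>Turns a coordinate of a vector-valued integral into a pairing with an L2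
        function, the form that weak convergence speaks about.\<close>
      have pull: "(LINT t|?M. c t *\<^sub>R w t) \<bullet> b = (LINT t|?M. w t \<bullet> (c t *\<^sub>R b))"
        if c: "continuous_on {0..T} c" and w: "L2 T w" for c w
      proof -
        have "integrable ?M (\<lambda>t. c t *\<^sub>R w t)"
        proof -
          have "bounded (c ` {0..T})"
            using c by (intro compact_imp_bounded compact_continuous_image) auto
          then obtain B where B: "\<forall>t\<in>{0..T}. norm (c t) \<le> B"
            by (auto simp: bounded_iff)
          show ?thesis
          proof (rule Bochner_Integration.integrable_bound)
            show "integrable ?M (\<lambda>t. B *\<^sub>R w t)"
              using L2_integrable[OF w] by simp
            show "(\<lambda>t. c t *\<^sub>R w t) \<in> borel_measurable ?M"
            proof (rule borel_measurable_scaleR)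
              show "c \<in> borel_measurable ?M"
                using c by (rule continuous_imp_measurable_on_sets_lebesgue) simp
              show "w \<in> borel_measurable ?M"
                using w by (simp add: L2_def)
            qed
            show "AE t in ?M. norm (c t *\<^sub>R w t) \<le> norm (B *\<^sub>R w t)"
              using B by (intro AE_I2) (auto intro!: mult_right_mono order_trans[OF _ abs_ge_self[of B]])
          qed
        qed
        then show ?thesis
          by (subst integral_inner_left[symmetric]) (auto simp: inner_commute)
      qed
      have "(\<lambda>n. LINT t|?M. x n t \<bullet> (deriv \<phi> t *\<^sub>R b)) \<longlonglongrightarrow> (LINT t|?M. y t \<bullet> (deriv \<phi> t *\<^sub>R b))"
      proof -
        have HK: "(LINT t|?M. w t \<bullet> (deriv \<phi> t *\<^sub>R b)) = integral {0..T} (\<lambda>t. w t \<bullet> (deriv \<phi> t *\<^sub>R b))"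
          if "continuous_on {0..T} w" for w :: "real \<Rightarrow> 'a"
          using that cont by (intro lebesgue_integral_eq_integral continuous_imp_integrable_real continuous_intros) auto
        have "uniform_limit {0..T} (\<lambda>n t. x n t \<bullet> (deriv \<phi> t *\<^sub>R b)) (\<lambda>t. y t \<bullet> (deriv \<phi> t *\<^sub>R b)) sequentially"
          by (intro bounded_bilinear.bounded_uniform_limit[OF bounded_bilinear_inner] unif uniform_limit_const
              compact_imp_bounded compact_continuous_image continuous_intros conty cont) auto
        then obtain I J where I: "\<And>n. ((\<lambda>t. x n t \<bullet> (deriv \<phi> t *\<^sub>R b)) has_integral I n) {0..T}"
          "((\<lambda>t. y t \<bullet> (deriv \<phi> t *\<^sub>R b)) has_integral J) {0..T}" "I \<longlonglongrightarrow> J"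
          by (rule uniform_limit_integral) (use contx cont in \<open>auto intro!: continuous_intros\<close>)
        show ?thesis
          unfolding HK[OF contx] HK[OF conty] integral_unique[OF I(1)] integral_unique[OF I(2)] by (rule I(3))
      qed
      moreover have "(LINT t|?M. x n t \<bullet> (deriv \<phi> t *\<^sub>R b)) = - (LINT t|?M. dot T (x n) t \<bullet> (\<phi> t *\<^sub>R b))" for n
      proof -
        have "(LINT t|?M. deriv \<phi> t *\<^sub>R x n t) = - (LINT t|?M. \<phi> t *\<^sub>R dot T (x n) t)"
          using W12_dot(2)[OF x \<open>T > 0\<close>, of n] \<phi> unfolding weak_derivative_def by blast
        from arg_cong[OF this, of "\<lambda>v. v \<bullet> b"] show ?thesis
          unfolding inner_minus_left pull[OF cont(1) W12_dot(1)[OF x \<open>T > 0\<close>]]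
            pull[OF cont(2) L2_continuous[OF contx]] .
      qed
      ultimately have "(\<lambda>n. - (LINT t|?M. dot T (x n) t \<bullet> (\<phi> t *\<^sub>R b))) \<longlonglongrightarrow> (LINT t|?M. y t \<bullet> (deriv \<phi> t *\<^sub>R b))"
        by (simp only:)
      moreover have "(\<lambda>n. - (LINT t|?M. dot T (x n) t \<bullet> (\<phi> t *\<^sub>R b))) \<longlonglongrightarrow> - (LINT t|?M. f t \<bullet> (\<phi> t *\<^sub>R b))"
        using weak L2b[OF cont(1)] unfolding weakly_tendsto_L2_def by (intro tendsto_minus) blast
      ultimately have "(LINT t|?M. y t \<bullet> (deriv \<phi> t *\<^sub>R b)) = - (LINT t|?M. f t \<bullet> (\<phi> t *\<^sub>R b))"
        by (rule LIMSEQ_unique)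
      then show ?thesis
        unfolding inner_minus_left pull[OF cont(1) f] pull[OF cont(2) L2_continuous[OF conty]] .
    qed
    show "(LINT t|?M. deriv \<phi> t *\<^sub>R y t) = - (LINT t|?M. \<phi> t *\<^sub>R f t)"
      by (rule euclidean_eqI) (rule eq)
  qed
  with ac f show ?thesis
    unfolding W12_def using L2_continuous[OF conty] by blast
qed

section \<open>Set-valued maps and a priori bounds\<close>

text \<open>Cutting \<open>[0,T]\<close> into steps on which \<open>\<mu>\<close> grows by at most \<open>1/2\<close> replaces the exponential of
  Gronwall's inequality; the number of steps depends on \<open>\<mu>\<close> only.\<close>

lemma uniform_bound_from_increments:
  fixes \<mu> :: "real \<Rightarrow> real" and x :: "'i \<Rightarrow> real \<Rightarrow> 'a::real_normed_vector"
  assumes \<mu>: "continuous_on {0..T} \<mu>" and "0 \<le> D"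
    and cont: "\<And>i. continuous_on {0..T} (x i)" and x0: "\<And>i. norm (x i 0) \<le> C"
    and incr: "\<And>i s t B. \<lbrakk>0 \<le> s; s \<le> t; t \<le> T; \<And>u. u \<in> {s..t} \<Longrightarrow> norm (x i u) \<le> B\<rbrakk>
      \<Longrightarrow> norm (x i t - x i s) \<le> (\<mu> t - \<mu> s) * (1 + B) + D"
  shows "\<exists>R\<ge>0. \<forall>i. \<forall>t\<in>{0..T}. norm (x i t) \<le> R"
proof -
  obtain d where "d > 0" and d: "\<And>s t. s \<in> {0..T} \<Longrightarrow> t \<in> {0..T} \<Longrightarrow> dist t s < d \<Longrightarrow> dist (\<mu> t) (\<mu> s) < 1 / 2"
    using compact_uniformly_continuous[OF \<mu> compact_Icc] unfolding uniformly_continuous_on_def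
    by (meson half_gt_zero zero_less_one)
  \<comment> \<open>Half of \<open>d\<close>, because the oscillation bound needs distances strictly
    below \<open>d\<close>.\<close>
  define \<delta> where "\<delta> = d / 2"
  have "\<delta> > 0"
    using \<open>d > 0\<close> by (simp add: \<delta>_def)
  define R where "R k = ((\<lambda>r. 2 * r + 1 + 2 * D) ^^ k) (max 0 C)" for k
  have R_Suc: "R (Suc k) = 2 * R k + 1 + 2 * D" for k
    by (simp add: R_def)
  have R_nonneg: "0 \<le> R k" for k
    by (induction k) (use \<open>0 \<le> D\<close> in \<open>simp_all add: R_Suc\<close>, simp add: R_def)
  obtain N where N: "T < real N * \<delta>"
    using reals_Archimedean3[OF \<open>\<delta> > 0\<close>] by blast
  have step: "norm (x i t) \<le> 2 * norm (x i s) + 1 + 2 * D"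
    if st: "0 \<le> s" "s \<le> t" "t \<le> T" "t - s < d" for i s t
  proof -
    have "continuous_on {s..t} (\<lambda>u. norm (x i u))"
      using st by (intro continuous_intros continuous_on_subset[OF cont]) auto
    \<comment> \<open>At a maximum point the bound B may be taken to be \<open>norm (x i w)\<close>,
      the quantity being estimated. It returns with factor 1/2 and is absorbed, whence the doubling
      in the recursion for \<open>R\<close>.\<close>
    then obtain w where w: "w \<in> {s..t}" "\<And>u. u \<in> {s..t} \<Longrightarrow> norm (x i u) \<le> norm (x i w)"
      using continuous_attains_sup[OF compact_Icc, of s t "\<lambda>u. norm (x i u)"] st by auto
    have "norm (x i w - x i s) \<le> (\<mu> w - \<mu> s) * (1 + norm (x i w)) + D"
      using w st by (intro incr) auto
    also have "(\<mu> w - \<mu> s) * (1 + norm (x i w)) \<le> 1 / 2 * (1 + norm (x i w))"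
    proof (rule mult_right_mono)
      have "dist (\<mu> w) (\<mu> s) < 1 / 2"
        using w st by (intro d) (auto simp: dist_real_def)
      then show "\<mu> w - \<mu> s \<le> 1 / 2"
        unfolding dist_real_def by linarith
    qed simp
    finally have "norm (x i w) \<le> norm (x i s) + 1 / 2 * (1 + norm (x i w)) + D"
      using norm_triangle_ineq2[of "x i w" "x i s"] by linarith
    moreover have "norm (x i t) \<le> norm (x i w)"
      using w(2) st by simp
    ultimately show ?thesis
      by (simp add: field_simps)
  qed
  have "\<forall>t\<in>{0..T}. t \<le> real k * \<delta> \<longrightarrow> norm (x i t) \<le> R k" for i k
  proof (induction k)
    case 0
    then show ?case
      using x0[of i] by (auto simp: R_def)
  next
    case (Suc k)
    show ?case
    proof (intro ballI impI)
      fix t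
      assume t: "t \<in> {0..T}" "t \<le> real (Suc k) * \<delta>"
      show "norm (x i t) \<le> R (Suc k)"
      proof (cases "t \<le> real k * \<delta>")
        case True
        then have "norm (x i t) \<le> R k"
          using Suc t by blast
        then show ?thesis
          using R_nonneg[of k] \<open>0 \<le> D\<close> by (simp add: R_Suc)
      next
        case False
        have "0 \<le> real k * \<delta>"
          using \<open>\<delta> > 0\<close> by simp
        moreover have "t - real k * \<delta> < d"
          using t(2) \<open>d > 0\<close> by (simp add: \<delta>_def algebra_simps)
        ultimately have "norm (x i t) \<le> 2 * norm (x i (real k * \<delta>)) + 1 + 2 * D"
          using False t by (intro step) auto
        moreover have "norm (x i (real k * \<delta>)) \<le> R k"
          using Suc False t \<open>0 \<le> real k * \<delta>\<close> by auto
        ultimately show ?thesis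
          by (simp add: R_Suc)
      qed
    qed
  qed
  then have "norm (x i t) \<le> R N" if "t \<in> {0..T}" for i t
    using N that by force
  then show ?thesis
    using R_nonneg by blast
qed

text \<open>For a fixed point, distance below r means that the set meets an open ball, an event
  covered by \<open>A\<close>. A moving point is then reached through a countable dense set.\<close>

lemma borel_measurable_infdist_set_valued:
  fixes A :: "'t \<Rightarrow> 'a::euclidean_space set" and w :: "'t \<Rightarrow> 'a"
  assumes A: "\<And>U. open U \<Longrightarrow> {t \<in> space M. A t \<inter> U \<noteq> {}} \<in> sets M"
    and ne: "\<And>t. t \<in> space M \<Longrightarrow> A t \<noteq> {}"
    and w [measurable]: "w \<in> borel_measurable M"
  shows "(\<lambda>t. infdist (w t) (A t)) \<in> borel_measurable M"
proof -
  have lessD: "\<exists>a\<in>S. dist v a < r" if "infdist v S < r" "S \<noteq> {}" for v r and S :: "'a set"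
    using that by (simp add: infdist_notempty cINF_less_iff)
  have fixed [measurable]: "(\<lambda>t. infdist q (A t)) \<in> borel_measurable M" for q
    unfolding borel_measurable_iff_less
  proof
    fix r
    have "infdist q (A t) < r \<longleftrightarrow> A t \<inter> ball q r \<noteq> {}" if "t \<in> space M" for t
    proof
      assume "infdist q (A t) < r"
      then show "A t \<inter> ball q r \<noteq> {}"
        using lessD[OF _ ne[OF that], of q r] by auto
    next
      assume "A t \<inter> ball q r \<noteq> {}"
      then obtain a where "a \<in> A t" "dist q a < r"
        by auto
      then show "infdist q (A t) < r"
        using infdist_le[of a "A t" q] by simp
    qed
    then have "{t \<in> space M. infdist q (A t) < r} = {t \<in> space M. A t \<inter> ball q r \<noteq> {}}"
      by blast
    then show "{t \<in> space M. infdist q (A t) < r} \<in> sets M"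
      using A by simp
  qed
  obtain Q :: "'a set" where Q: "countable Q" "\<And>X. open X \<Longrightarrow> X \<noteq> {} \<Longrightarrow> \<exists>q\<in>Q. q \<in> X"
    using countable_dense_setE by blast
  show ?thesis
    unfolding borel_measurable_iff_less
  proof
    fix r
    have "infdist (w t) (A t) < r \<longleftrightarrow> (\<exists>q\<in>Q. dist (w t) q + infdist q (A t) < r)" for t
    proof
      assume less: "infdist (w t) (A t) < r"
      \<comment> \<open>The slack is halved because moving to \<open>q\<close> is paid for twice, in
        the distance to \<open>q\<close> and in the change of \<open>infdist\<close>.\<close>
      define e where "e = (r - infdist (w t) (A t)) / 2"
      have "e > 0"
        using less by (simp add: e_def)
      then have "ball (w t) e \<noteq> {}"
        by simp
      then obtain q where q: "q \<in> Q" "q \<in> ball (w t) e"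
        using Q(2)[OF open_ball] by blast
      have "infdist q (A t) \<le> infdist (w t) (A t) + dist q (w t)"
        by (rule infdist_triangle)
      then have "dist (w t) q + infdist q (A t) < r"
        using q(2) by (simp add: e_def dist_commute)
      with q(1) show "\<exists>q\<in>Q. dist (w t) q + infdist q (A t) < r"
        by blast
    next
      assume "\<exists>q\<in>Q. dist (w t) q + infdist q (A t) < r"
      then obtain q where "dist (w t) q + infdist q (A t) < r"
        by blast
      then show "infdist (w t) (A t) < r"
        using infdist_triangle[of "w t" "A t" q] by linarith
    qed
    then have "{t \<in> space M. infdist (w t) (A t) < r}
        = (\<Union>q\<in>Q. {t \<in> space M. dist (w t) q + infdist q (A t) < r})"
      by auto
    also have "\<dots> \<in> sets M"
    proof (rule sets.countable_UN'[OF Q(1)])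
      have "{t \<in> space M. dist (w t) q + infdist q (A t) < r} \<in> sets M" for q
        by measurable
      then show "(\<lambda>q. {t \<in> space M. dist (w t) q + infdist q (A t) < r}) ` Q \<subseteq> sets M"
        by blast
    qed
    finally show "{t \<in> space M. infdist (w t) (A t) < r} \<in> sets M" .
  qed
qed

lemma convex_infdist_le:
  fixes S :: "'a::euclidean_space set"
  assumes "convex S" "closed S" "S \<noteq> {}"
  shows "convex {v. infdist v S \<le> r}"
proof (rule convexI)
  fix v w :: 'a and a b :: real
  assume vw: "v \<in> {v. infdist v S \<le> r}" "w \<in> {v. infdist v S \<le> r}" and ab: "0 \<le> a" "0 \<le> b" "a + b = 1"
  obtain v' w' where v': "v' \<in> S" "infdist v S = dist v v'" and w': "w' \<in> S" "infdist w S = dist w w'"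
    using infdist_attains_inf[OF assms(2,3)] by metis
  have "a *\<^sub>R v' + b *\<^sub>R w' \<in> S"
    using assms(1) v' w' ab by (auto intro: convexD)
  then have "infdist (a *\<^sub>R v + b *\<^sub>R w) S \<le> dist (a *\<^sub>R v + b *\<^sub>R w) (a *\<^sub>R v' + b *\<^sub>R w')"
    by (rule infdist_le)
  also have "\<dots> = norm (a *\<^sub>R (v - v') + b *\<^sub>R (w - w'))"
    by (simp add: dist_norm algebra_simps)
  also have "\<dots> \<le> a * dist v v' + b * dist w w'"
    using ab norm_triangle_ineq[of "a *\<^sub>R (v - v')" "b *\<^sub>R (w - w')"] by (simp add: dist_norm)
  also have "\<dots> \<le> a * r + b * r"
    using ab vw v' w' by (intro add_mono mult_left_mono) auto
  also have "\<dots> = r"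
    using ab by (simp add: distrib_right[symmetric])
  finally show "a *\<^sub>R v + b *\<^sub>R w \<in> {v. infdist v S \<le> r}"
    by simp
qed

text \<open>The vectors \<open>v n t\<close> lie near the moving sets \<open>G (xs n)\<close>, which
  eventually lie in a neighbourhood of \<open>G x\<close>. Thus a whole tail lies in a closed convex
  neighbourhood of \<open>G x\<close>, which also contains the averages and their limit; closedness
  of \<open>G x\<close> finishes.\<close>

lemma usc_closure:
  fixes G :: "'b::topological_space \<Rightarrow> 'a::euclidean_space set"
  assumes usc: "usc_at G x" and G: "convex (G x)" "closed (G x)" "G x \<noteq> {}"
    and ne: "\<And>n. G (xs n) \<noteq> {}" "\<And>n. closed (G (xs n))"
    and xs: "xs \<longlonglongrightarrow> x"
    and v: "(\<lambda>n. infdist (v n t) (G (xs n))) \<longlonglongrightarrow> 0"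
    and h: "\<And>n. h n \<in> midhull (v ` {n..})" and lim: "(\<lambda>n. h n t) \<longlonglongrightarrow> y"
  shows "y \<in> G x"
proof -
  have "infdist y (G x) \<le> e" if "e > 0" for e
  proof -
    \<comment> \<open>One half of \<open>e\<close> for the distance from \<open>G (xs n)\<close> to
      \<open>G x\<close>, the other for the distance from \<open>v n t\<close> to
      \<open>G (xs n)\<close>.\<close>
    define U where "U = {a. infdist a (G x) < e / 2}"
    have "open U"
      unfolding U_def by (intro open_Collect_less continuous_intros)
    moreover have "G x \<subseteq> U"
      using \<open>e > 0\<close> by (auto simp: U_def)
    ultimately obtain V where V: "open V" "x \<in> V" "\<And>z. z \<in> V \<Longrightarrow> G z \<subseteq> U"
      using usc unfolding usc_at_def by meson
    have "\<forall>\<^sub>F n in sequentially. xs n \<in> V"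
      using topological_tendstoD[OF xs V(1,2)] .
    moreover have "\<forall>\<^sub>F n in sequentially. infdist (v n t) (G (xs n)) < e / 2"
      using v \<open>e > 0\<close> by (intro order_tendstoD(2)) auto
    ultimately have "\<forall>\<^sub>F n in sequentially. infdist (v n t) (G x) \<le> e"
    proof eventually_elim
      case (elim n)
      obtain a where a: "a \<in> G (xs n)" "infdist (v n t) (G (xs n)) = dist (v n t) a"
        using infdist_attains_inf[OF ne(2,1)] by blast
      have "infdist (v n t) (G x) \<le> infdist a (G x) + dist (v n t) a"
        by (rule infdist_triangle)
      then show ?case
        using a elim V(3) by (fastforce simp: U_def)
    qed
    then obtain N where N: "\<And>n. n \<ge> N \<Longrightarrow> infdist (v n t) (G x) \<le> e"
      by (auto simp: eventually_sequentially)
    have "h n t \<in> {a. infdist a (G x) \<le> e}" if "n \<ge> N" for n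
      using N that by (intro midhull_pointwise[OF h[of n] convex_infdist_le[OF G]]) auto
    moreover have "(\<lambda>n. infdist (h n t) (G x)) \<longlonglongrightarrow> infdist y (G x)"
      using lim by (rule tendsto_infdist)
    ultimately show ?thesis
      by (intro LIMSEQ_le_const2) auto
  qed
  then have "infdist y (G x) = 0"
    using infdist_nonneg[of y "G x"] by (meson dense_ge order.antisym)
  then show ?thesis
    using G in_closed_iff_infdist_zero by blast
qed

section \<open>Measurability of the distance to F along a curve, and exactness\<close>

context
  fixes T :: real and x0 :: "'a::euclidean_space" and F :: "real \<Rightarrow> 'a \<Rightarrow> 'a set"
  assumes T: "T > 0"
    and H1: "\<And>t x. t \<in> {0..T} \<Longrightarrow> F t x \<noteq> {} \<and> closed (F t x) \<and> convex (F t x)"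
    and H2_measurable: "\<And>U. open U \<Longrightarrow>
          {(t, x). t \<in> {0..T} \<and> F t x \<inter> U \<noteq> {}} \<in> sets (lebesgue_on {0..T} \<Otimes>\<^sub>M borel)"
begin

text \<open>The map \<open>\<lambda>t. (t, x t)\<close> is measurable into the product, so joint
  measurability of F restricts to the graph of \<open>x\<close>.\<close>

lemma measurable_defect:
  assumes x: "x \<in> W12 T"
  shows "(\<lambda>t. infdist (dot T x t) (F t (x t))) \<in> borel_measurable (lebesgue_on {0..T})"
proof (rule borel_measurable_infdist_set_valued)
  show "dot T x \<in> borel_measurable (lebesgue_on {0..T})"
    using W12_dot(1)[OF x T] by (simp add: L2_def)
  show "F t (x t) \<noteq> {}" if "t \<in> space (lebesgue_on {0..T})" for t
    using H1[of t "x t"] that by simp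
  fix U :: "'a set"
  assume "open U"
  have "continuous_on {0..T} x"
    using x by (auto simp: W12_def intro: abs_continuous_on_imp_continuous_on)
  then have [measurable]: "x \<in> borel_measurable (lebesgue_on {0..T})"
    by (rule continuous_imp_measurable_on_sets_lebesgue) simp
  have "(\<lambda>t. (t, x t)) \<in> lebesgue_on {0..T} \<rightarrow>\<^sub>M lebesgue_on {0..T} \<Otimes>\<^sub>M borel"
    by measurable
  from measurable_sets[OF this H2_measurable[OF \<open>open U\<close>]]
  have "(\<lambda>t. (t, x t)) -` {(t, x). t \<in> {0..T} \<and> F t x \<inter> U \<noteq> {}} \<inter> space (lebesgue_on {0..T})
    \<in> sets (lebesgue_on {0..T})" .
  also have "(\<lambda>t. (t, x t)) -` {(t, x). t \<in> {0..T} \<and> F t x \<inter> U \<noteq> {}} \<inter> space (lebesgue_on {0..T})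
    = {t \<in> space (lebesgue_on {0..T}). F t (x t) \<inter> U \<noteq> {}}"
    by auto
  finally show "{t \<in> space (lebesgue_on {0..T}). F t (x t) \<inter> U \<noteq> {}} \<in> sets (lebesgue_on {0..T})" .
qed

text \<open>A nonnegative measurable integrand has integral 0 iff it vanishes a.e., and for a closed
  set distance 0 is membership.\<close>

lemma residual_eq_0_iff:
  assumes x: "x \<in> admissible T x0"
  shows "residual T F x = 0 \<longleftrightarrow> x \<in> solutions T F x0"
proof -
  let ?M = "lebesgue_on {0..T}"
  have W: "x \<in> W12 T" and "x 0 = x0" and ac: "abs_continuous_on {0..T} x"
    using x by (auto simp: admissible_def W12_def)
  have dom: "AE t in ?M. t \<in> {0..T}"
    by (rule AE_I2) simp
  note [measurable] = measurable_defect[OF W]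
  have "residual T F x = 0 \<longleftrightarrow> (AE t in ?M. infdist (dot T x t) (F t (x t)) = 0)"
    unfolding residual_def by (subst nn_integral_0_iff_AE) auto
  also have "\<dots> \<longleftrightarrow> (AE t in ?M. \<exists>v\<in>F t (x t). (x has_vector_derivative v) (at t within {0..T}))"
  proof
    assume "AE t in ?M. infdist (dot T x t) (F t (x t)) = 0"
    with W12_dot(4)[OF W T] dom
    show "AE t in ?M. \<exists>v\<in>F t (x t). (x has_vector_derivative v) (at t within {0..T})"
    proof eventually_elim
      case (elim t)
      then have "dot T x t \<in> F t (x t)"
        using H1[of t "x t"] in_closed_iff_infdist_zero by blast
      with elim show ?case
        by blast
    qed
  next
    assume "AE t in ?M. \<exists>v\<in>F t (x t). (x has_vector_derivative v) (at t within {0..T})"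
    with dom show "AE t in ?M. infdist (dot T x t) (F t (x t)) = 0"
    proof eventually_elim
      case (elim t)
      then obtain v where v: "v \<in> F t (x t)" "(x has_vector_derivative v) (at t within {0..T})"
        by blast
      show ?case
        unfolding vector_derivative_within_Icc[OF elim(1) T v(2)] using v(1) by simp
    qed
  qed
  also have "\<dots> \<longleftrightarrow> x \<in> solutions T F x0"
    using ac \<open>x 0 = x0\<close> by (simp add: solutions_def)
  finally show ?thesis .
qed

lemma defect_energy:
  assumes x: "x \<in> W12 T" and r: "residual T F x \<le> ennreal r" "0 \<le> r"
  shows "integrable (lebesgue_on {0..T}) (\<lambda>t. (infdist (dot T x t) (F t (x t)))\<^sup>2)"
    and "(LINT t|lebesgue_on {0..T}. (infdist (dot T x t) (F t (x t)))\<^sup>2) \<le> r"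
proof -
  note [measurable] = measurable_defect[OF x]
  show int: "integrable (lebesgue_on {0..T}) (\<lambda>t. (infdist (dot T x t) (F t (x t)))\<^sup>2)"
  proof (rule integrableI_nonneg)
    show "(\<integral>\<^sup>+ t. ennreal ((infdist (dot T x t) (F t (x t)))\<^sup>2) \<partial>lebesgue_on {0..T}) < \<infinity>"
      using le_less_trans[OF r(1) ennreal_less_top] unfolding residual_def by simp
  qed simp_all
  have "ennreal (LINT t|lebesgue_on {0..T}. (infdist (dot T x t) (F t (x t)))\<^sup>2) = residual T F x"
    unfolding residual_def using int by (intro nn_integral_eq_integral[symmetric]) auto
  then show "(LINT t|lebesgue_on {0..T}. (infdist (dot T x t) (F t (x t)))\<^sup>2) \<le> r"
    unfolding ennreal_le_iff[OF r(2), symmetric] using r(1) by simp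
qed

end

lemma AE_lebesgue_on_subinterval:
  assumes "AE t in lebesgue_on {a..b::real}. P t" "{c..d} \<subseteq> {a..b}"
  shows "AE t in lebesgue_on {c..d}. P t"
  using assms unfolding AE_lebesgue_on_iff_negligible by (rule_tac negligible_subset) auto

text \<open>The bounds are summable and decreasing, so they survive the passage to a further
  subsequence.\<close>

lemma fast_subsequence:
  fixes \<rho> :: "nat \<Rightarrow> ennreal"
  assumes "\<rho> \<longlonglongrightarrow> 0"
  obtains r :: "nat \<Rightarrow> nat" where "strict_mono r" "\<And>n. \<rho> (r n) \<le> ennreal ((1 / 2) ^ n)"
proof -
  have "\<forall>\<^sub>F k in sequentially. \<rho> k < ennreal ((1 / 2) ^ n)" for n
    using assms by (rule order_tendstoD(2)) simp
  then obtain N where N: "\<And>n k. N n \<le> k \<Longrightarrow> \<rho> k < ennreal ((1 / 2) ^ n)"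
    unfolding eventually_sequentially by metis
  define r where "r n = n + (\<Sum>i\<le>n. N i)" for n
  have "N n \<le> r n" for n
    unfolding r_def by (rule trans_le_add2) (auto intro: member_le_sum)
  then have "\<rho> (r n) \<le> ennreal ((1 / 2) ^ n)" for n
    using N less_imp_le by blast
  moreover have "strict_mono r"
    by (auto simp: strict_mono_Suc_iff r_def)
  ultimately show ?thesis
    using that by blast
qed

section \<open>A priori estimates and asymptotic consistency\<close>

context
  fixes T :: real and x0 :: "'a::euclidean_space" and F :: "real \<Rightarrow> 'a \<Rightarrow> 'a set"
    and m :: "real \<Rightarrow> real"
  assumes T: "T > 0"
    and H1: "\<And>t x. t \<in> {0..T} \<Longrightarrow> F t x \<noteq> {} \<and> closed (F t x) \<and> convex (F t x)"
    and H2_measurable: "\<And>U. open U \<Longrightarrow>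
          {(t, x). t \<in> {0..T} \<and> F t x \<inter> U \<noteq> {}} \<in> sets (lebesgue_on {0..T} \<Otimes>\<^sub>M borel)"
    and H2_usc: "AE t in lebesgue_on {0..T}. usc (F t)"
    and m: "L2 T m" "\<And>t. 0 \<le> m t"
    and growth: "AE t in lebesgue_on {0..T}. \<forall>x. \<forall>v\<in>F t x. norm v \<le> m t * (1 + norm x)"
begin

text \<open>A nearest point of \<open>F t (x t)\<close> splits the velocity into a part of linear
  growth and a remainder whose norm is the distance.\<close>

lemma velocity_bound:
  "AE t in lebesgue_on {0..T}.
    norm (dot T x t) \<le> m t * (1 + norm (x t)) + infdist (dot T x t) (F t (x t))"
proof -
  have "AE t in lebesgue_on {0..T}. t \<in> {0..T}"
    by (rule AE_I2) simp
  with growth show ?thesis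
  proof eventually_elim
    case (elim t)
    then obtain v where v: "v \<in> F t (x t)" "infdist (dot T x t) (F t (x t)) = dist (dot T x t) v"
      using infdist_attains_inf[of "F t (x t)"] H1[of t "x t"] by blast
    then have "norm v \<le> m t * (1 + norm (x t))"
      using elim by blast
    moreover have "norm (dot T x t) \<le> norm v + dist (dot T x t) v"
      using norm_triangle_ineq2[of "dot T x t" v] by (simp add: dist_norm)
    ultimately show ?case
      using v by linarith
  qed
qed

text \<open>The form demanded by \<open>uniform_bound_from_increments\<close>, with the primitive of
  \<open>m\<close> as \<mu>. The constant \<open>T + 1\<close> comes from bounding the distance d by
  1 + d^2 and integrating, the residual being at most 1.\<close>

lemma increment_bound:
  assumes x: "x \<in> W12 T" and r: "residual T F x \<le> 1"
    and st: "0 \<le> s" "s \<le> t" "t \<le> T" and B: "\<And>u. u \<in> {s..t} \<Longrightarrow> norm (x u) \<le> B"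
  shows "norm (x t - x s) \<le> (integral {0..t} m - integral {0..s} m) * (1 + B) + (T + 1)"
proof -
  define d where "d u = infdist (dot T x u) (F u (x u))" for u
  have r': "residual T F x \<le> ennreal 1"
    using r by simp
  have d2: "integrable (lebesgue_on {0..T}) (\<lambda>u. (d u)\<^sup>2)" "(LINT u|lebesgue_on {0..T}. (d u)\<^sup>2) \<le> 1"
    using defect_energy[OF T H1 H2_measurable x r'] unfolding d_def by simp_all
  have sub: "{s..t} \<subseteq> {0..T}"
    using st by auto
  have int: "integrable (lebesgue_on {s..t}) (dot T x)" "integrable (lebesgue_on {s..t}) m"
    "integrable (lebesgue_on {s..t}) (\<lambda>u. (d u)\<^sup>2)"
    using integrable_subinterval[OF _ sub] L2_integrable[OF W12_dot(1)[OF x T]] L2_integrable[OF m(1)] d2(1)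
    by blast+
  have HK: "dot T x integrable_on {0..T}" "m integrable_on {0..T}"
    using L2_integrable[OF W12_dot(1)[OF x T]] L2_integrable[OF m(1)] by (auto intro: integrable_on_lebesgue_on)
  have "x t - x s = integral {s..t} (dot T x)"
    using W12_dot(3)[OF x T, of s] W12_dot(3)[OF x T, of t] indefinite_integral_diff[OF HK(1) st] st by simp
  also have "\<dots> = (LINT u|lebesgue_on {s..t}. dot T x u)"
    using int by (intro lebesgue_integral_eq_integral[symmetric]) auto
  also have "norm \<dots> \<le> (LINT u|lebesgue_on {s..t}. norm (dot T x u))"
    by (rule integral_norm_bound)
  also have "\<dots> \<le> (LINT u|lebesgue_on {s..t}. m u * (1 + B) + (1 + (d u)\<^sup>2))"
  proof (rule integral_mono_AE)
    have "AE u in lebesgue_on {s..t}. u \<in> {s..t}"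
      by (rule AE_I2) simp
    with AE_lebesgue_on_subinterval[OF velocity_bound sub, of x]
    show "AE u in lebesgue_on {s..t}. norm (dot T x u) \<le> m u * (1 + B) + (1 + (d u)\<^sup>2)"
    proof eventually_elim
      case (elim u)
      have "m u * (1 + norm (x u)) \<le> m u * (1 + B)"
        using m(2) B[OF elim(2)] by (intro mult_left_mono) auto
      moreover have "d u \<le> 1 + (d u)\<^sup>2"
        using zero_le_power2[of "d u - 1"] infdist_nonneg[of "dot T x u" "F u (x u)"]
        by (simp add: power2_diff d_def)
      ultimately show ?case
        using elim(1) unfolding d_def by linarith
    qed
  qed (use int in auto)
  also have "\<dots> = (LINT u|lebesgue_on {s..t}. m u) * (1 + B)
      + (LINT u|lebesgue_on {s..t}. 1 + (d u)\<^sup>2)"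
    using int by simp
  also have "(LINT u|lebesgue_on {s..t}. m u) = integral {0..t} m - integral {0..s} m"
    using int indefinite_integral_diff[OF HK(2) st] lebesgue_integral_eq_integral[of "{s..t}" m] by simp
  finally have "norm (x t - x s) \<le> (integral {0..t} m - integral {0..s} m) * (1 + B)
      + (LINT u|lebesgue_on {s..t}. 1 + (d u)\<^sup>2)" .
  moreover have "(LINT u|lebesgue_on {s..t}. 1 + (d u)\<^sup>2) \<le> (LINT u|lebesgue_on {0..T}. 1 + (d u)\<^sup>2)"
  proof (rule has_integral_subset_le[OF sub])
    show "((\<lambda>u. 1 + (d u)\<^sup>2) has_integral (LINT u|lebesgue_on {s..t}. 1 + (d u)\<^sup>2)) {s..t}"
      using int by (intro has_integral_integral_lebesgue_on) auto
    show "((\<lambda>u. 1 + (d u)\<^sup>2) has_integral (LINT u|lebesgue_on {0..T}. 1 + (d u)\<^sup>2)) {0..T}"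
      using d2 by (intro has_integral_integral_lebesgue_on) auto
  qed auto
  moreover have "(LINT u|lebesgue_on {0..T}. 1 + (d u)\<^sup>2) \<le> T + 1"
    using d2 T by (simp add: measure_restrict_space)
  ultimately show ?thesis
    by linarith
qed

lemma energy_dot_bound:
  assumes x: "x \<in> W12 T" and r: "residual T F x \<le> 1" and R: "\<And>t. t \<in> {0..T} \<Longrightarrow> norm (x t) \<le> R"
  shows "energy T (dot T x) \<le> 2 * (1 + R)\<^sup>2 * energy T m + 2"
proof -
  let ?M = "lebesgue_on {0..T}"
  define d where "d u = infdist (dot T x u) (F u (x u))" for u
  have r': "residual T F x \<le> ennreal 1"
    using r by simp
  have d2: "integrable ?M (\<lambda>u. (d u)\<^sup>2)" "(LINT u|?M. (d u)\<^sup>2) \<le> 1"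
    using defect_energy[OF T H1 H2_measurable x r'] unfolding d_def by simp_all
  have m2: "integrable ?M (\<lambda>u. (m u)\<^sup>2)"
    using m(1) by (simp add: L2_def)
  have "energy T (dot T x) \<le> (LINT u|?M. 2 * (1 + R)\<^sup>2 * (m u)\<^sup>2 + 2 * (d u)\<^sup>2)"
    unfolding energy_def
  proof (rule integral_mono_AE)
    show "integrable ?M (\<lambda>u. (norm (dot T x u))\<^sup>2)"
      using W12_dot(1)[OF x T] by (simp add: L2_def)
    show "integrable ?M (\<lambda>u. 2 * (1 + R)\<^sup>2 * (m u)\<^sup>2 + 2 * (d u)\<^sup>2)"
      using m2 d2(1) by simp
    have "AE u in ?M. u \<in> {0..T}"
      by (rule AE_I2) simp
    with velocity_bound[of x]
    show "AE u in ?M. (norm (dot T x u))\<^sup>2 \<le> 2 * (1 + R)\<^sup>2 * (m u)\<^sup>2 + 2 * (d u)\<^sup>2"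
    proof eventually_elim
      case (elim u)
      have "m u * (1 + norm (x u)) \<le> m u * (1 + R)"
        using m(2) R[OF elim(2)] by (intro mult_left_mono) auto
      then have "norm (dot T x u) \<le> m u * (1 + R) + d u"
        using elim(1) by (simp add: d_def)
      then have "(norm (dot T x u))\<^sup>2 \<le> (m u * (1 + R) + d u)\<^sup>2"
        by (intro power_mono) auto
      also have "\<dots> \<le> 2 * (m u * (1 + R))\<^sup>2 + 2 * (d u)\<^sup>2"
        using norm_add_power2_le[of "m u * (1 + R)" "d u"] by simp
      finally show ?case
        by (simp add: power_mult_distrib mult_ac)
    qed
  qed
  also have "\<dots> = 2 * (1 + R)\<^sup>2 * energy T m + 2 * (LINT u|?M. (d u)\<^sup>2)"
    using m2 d2(1) by (simp add: energy_def)
  finally show ?thesis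
    using d2(2) by linarith
qed

lemma subsequence_converges_to_solution:
  assumes x: "\<And>n. x n \<in> admissible T x0" and res: "(\<lambda>n. residual T F (x n)) \<longlonglongrightarrow> 0"
  shows "\<exists>r xs. strict_mono (r :: nat \<Rightarrow> nat) \<and> xs \<in> admissible T x0 \<and>
          uniform_limit {0..T} (\<lambda>n. x (r n)) xs sequentially \<and>
          weakly_tendsto_L2 T (\<lambda>n. dot T (x (r n))) (dot T xs) \<and>
          xs \<in> solutions T F x0"
proof -
  let ?M = "lebesgue_on {0..T}"
  \<comment> \<open>The rate is fixed before compactness is used: it makes all residuals at most 1,
    as the a priori bounds require, and the Arzela-Ascoli subsequence keeps it because
    \<open>k n\<close> is at least \<open>n\<close>.\<close>
  obtain r0 :: "nat \<Rightarrow> nat" where r0: "strict_mono r0" and small: "\<And>n. residual T F (x (r0 n)) \<le> ennreal ((1 / 2) ^ n)"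
    using fast_subsequence[OF res] by blast
  define u where "u n = x (r0 n)" for n
  have uW: "u n \<in> W12 T" and u0: "u n 0 = x0" for n
    using x by (auto simp: u_def admissible_def)
  have ures: "residual T F (u n) \<le> 1" for n
  proof -
    have "ennreal ((1 / 2) ^ n) \<le> ennreal 1"
      by (intro ennreal_leI power_le_one) auto
    with small[of n] show ?thesis
      unfolding u_def by (simp add: order_trans)
  qed
  have ucont: "continuous_on {0..T} (u n)" for n
    using uW[of n] by (auto simp: W12_def intro: abs_continuous_on_imp_continuous_on)
  have "continuous_on {0..T} (\<lambda>t. integral {0..t} m)"
    using L2_integrable[OF m(1)] by (intro indefinite_integral_continuous_1 integrable_on_lebesgue_on) auto
  moreover have "0 \<le> T + 1"
    using T by simp
  ultimately obtain R where R0: "0 \<le> R" and "\<forall>n. \<forall>t\<in>{0..T}. norm (u n t) \<le> R"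
    using uniform_bound_from_increments[of T "\<lambda>t. integral {0..t} m" "T + 1" u "norm x0"]
      ucont u0 increment_bound[OF uW ures] by auto
  then have uR: "norm (u n t) \<le> R" if "t \<in> {0..T}" for n t
    using that by blast
  define K where "K = 2 * (1 + R)\<^sup>2 * energy T m + 2"
  have K: "energy T (dot T (u n)) \<le> K" for n
    unfolding K_def using uR by (intro energy_dot_bound uW ures) auto
  have "K > 0"
    unfolding K_def using energy_nonneg[of T m] by (intro add_nonneg_pos mult_nonneg_nonneg) auto
  have osc: "norm (u n t - u n s) \<le> (t - s) / l + l * K" if "0 \<le> s" "s \<le> t" "t \<le> T" "l > 0" for n s t l
  proof -
    have L2: "L2 T (dot T (u n))"
      by (rule W12_dot(1)[OF uW T])
    have int2: "integrable ?M (\<lambda>t. (norm (dot T (u n) t))\<^sup>2)"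
      using L2 by (simp add: L2_def)
    have "dot T (u n) integrable_on {0..T}"
      using L2_integrable[OF L2] by (intro integrable_on_lebesgue_on) auto
    then have "u n t - u n s = integral {s..t} (dot T (u n))"
      using W12_dot(3)[OF uW T, of s n] W12_dot(3)[OF uW T, of t n] indefinite_integral_diff that by simp
    moreover have "norm (integral {s..t} (dot T (u n)))
        \<le> (t - s) / l + l * integral {s..t} (\<lambda>t. (norm (dot T (u n) t))\<^sup>2)"
      by (rule L2_norm_integral_le[OF L2 that])
    moreover have "integral {s..t} (\<lambda>t. (norm (dot T (u n) t))\<^sup>2) \<le> integral {0..T} (\<lambda>t. (norm (dot T (u n) t))\<^sup>2)"
      using that int2 by (intro integral_subset_le integrable_on_subinterval_lebesgue_on[OF int2]) auto
    moreover have "integral {0..T} (\<lambda>t. (norm (dot T (u n) t))\<^sup>2) = energy T (dot T (u n))"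
      unfolding energy_def using int2 by (intro lebesgue_integral_eq_integral[symmetric]) auto
    ultimately have "integral {s..t} (\<lambda>t. (norm (dot T (u n) t))\<^sup>2) \<le> K"
      using K[of n] by linarith
    then have "l * integral {s..t} (\<lambda>t. (norm (dot T (u n) t))\<^sup>2) \<le> l * K"
      using \<open>l > 0\<close> by (intro mult_left_mono) auto
    with \<open>norm (integral {s..t} (dot T (u n))) \<le> _\<close> \<open>u n t - u n s = _\<close> show ?thesis
      by simp
  qed
  have equi: "\<exists>d>0. \<forall>n s. s \<in> {0..T} \<and> norm (t - s) < d \<longrightarrow> norm (u n t - u n s) < e"
    if t: "t \<in> {0..T}" and "0 < e" for t e :: real
  proof (intro exI conjI allI impI)
    \<comment> \<open>The energy term becomes \<open>e / 2\<close> for all n at once, since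
      \<open>K\<close> does not depend on n; the distance condition makes the other term smaller
      than \<open>e / 2\<close>.\<close>
    define l where "l = e / (2 * K)"
    have "l > 0"
      using \<open>0 < e\<close> \<open>K > 0\<close> by (simp add: l_def)
    show "0 < l * e / 2"
      using \<open>l > 0\<close> \<open>0 < e\<close> by simp
    fix n s
    assume s: "s \<in> {0..T} \<and> norm (t - s) < l * e / 2"
    have "norm (u n t - u n s) \<le> \<bar>t - s\<bar> / l + l * K"
    proof (cases "s \<le> t")
      case True
      then show ?thesis
        using osc[of s t l n] s t \<open>l > 0\<close> by simp
    next
      case False
      then show ?thesis
        using osc[of t s l n] s t \<open>l > 0\<close> by (simp add: norm_minus_commute)
    qed
    also have "\<bar>t - s\<bar> / l < e / 2"
      using s \<open>l > 0\<close> by (simp add: pos_divide_less_eq mult.commute)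
    also have "e / 2 + l * K = e"
      using \<open>K > 0\<close> by (simp add: l_def)
    finally show "norm (u n t - u n s) < e"
      by simp
  qed
  obtain xs k where k: "strict_mono (k :: nat \<Rightarrow> nat)"
    and xs: "\<And>e. 0 < e \<Longrightarrow> \<exists>N. \<forall>n t. n \<ge> N \<and> t \<in> {0..T} \<longrightarrow> norm (u (k n) t - xs t) < e"
    by (rule Arzela_Ascoli[of "{0..T}" u R]) (simp, erule uR, erule (1) equi, rule that)
  define z where "z n = u (k n)" for n
  define g where "g n = dot T (z n)" for n
  have zW: "z n \<in> W12 T" and z0: "z n 0 = x0" for n
    by (simp_all add: z_def uW u0)
  have gL2: "L2 T (g n)" and gK: "energy T (g n) \<le> K" for n
    using W12_dot(1)[OF uW T] K by (simp_all add: g_def z_def)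
  have unif: "uniform_limit {0..T} z xs sequentially"
    unfolding uniform_limit_iff eventually_sequentially z_def dist_norm using xs by blast
  have lim: "(\<lambda>n. z n t) \<longlonglongrightarrow> xs t" if "t \<in> {0..T}" for t
    using tendsto_uniform_limitI[OF unif that] .
  have "(\<lambda>n. z n 0) \<longlonglongrightarrow> xs 0"
    using T by (intro lim) simp
  then have xs0: "xs 0 = x0"
    by (simp add: z0 LIMSEQ_const_iff)
  have prim: "(\<lambda>n. integral {0..t} (g n)) \<longlonglongrightarrow> xs t - x0" if "t \<in> {0..T}" for t
  proof -
    have "integral {0..t} (g n) = z n t - x0" for n
      using W12_dot(3)[OF zW T that, of n] z0[of n] by (simp add: g_def)
    then show ?thesis
      using lim[OF that] by (simp add: tendsto_diff)
  qed
  obtain h f where h: "\<And>n. h n \<in> midhull (g ` {n..})" and f: "L2 T f"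
    and hf: "AE t in ?M. (\<lambda>n. h n t) \<longlonglongrightarrow> f t"
    and "\<And>\<psi>. L2 T \<psi> \<Longrightarrow> (\<lambda>n. LINT t|?M. h n t \<bullet> \<psi> t) \<longlonglongrightarrow> (LINT t|?M. f t \<bullet> \<psi> t)"
    and xsf: "\<And>t. t \<in> {0..T} \<Longrightarrow> xs t - x0 = integral {0..t} f"
    by (rule midhull_limit_of_indefinite_integrals[of T g K "\<lambda>t. xs t - x0", OF gL2 gK prim])
       (assumption, rule that)
  have xs_rep: "xs t = xs 0 + integral {0..t} f" if "t \<in> {0..T}" for t
    using xsf[OF that] xs0 by (simp add: algebra_simps)
  have "weakly_tendsto_L2 T g f"
    using prim by (intro weakly_tendsto_L2_of_indefinite_integrals[OF T gL2 gK f]) (simp add: xsf)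
  then have xsW: "xs \<in> W12 T"
    using W12_indefinite_integral_limit[OF T zW f unif xs_rep] by (simp add: g_def[abs_def])
  \<comment> \<open>Now that \<open>xs\<close> is in \<open>W12\<close>, its classical derivative
    has the same primitive as \<open>f\<close>, so the criterion applies again with it as the
    limit.\<close>
  have weak: "weakly_tendsto_L2 T g (dot T xs)"
  proof (rule weakly_tendsto_L2_of_indefinite_integrals[OF T gL2 gK W12_dot(1)[OF xsW T]])
    show "(\<lambda>n. integral {0..t} (g n)) \<longlonglongrightarrow> integral {0..t} (dot T xs)" if "t \<in> {0..T}" for t
      using prim[OF that] W12_dot(3)[OF xsW T that] xs0 by simp
  qed
  \<comment> \<open>Convergence of the residuals in the mean would give a.e. convergence of the
    distances only along another subsequence; summability gives it along the whole sequence.\<close>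
  have "AE t in ?M. summable (\<lambda>n. (infdist (g n t) (F t (z n t)))\<^sup>2)"
  proof (rule AE_summable_of_summable_integrals)
    have "residual T F (z n) \<le> ennreal ((1 / 2) ^ n)" for n
    proof -
      have "(1 / 2 :: real) ^ k n \<le> (1 / 2) ^ n"
        using seq_suble[OF k] by (intro power_decreasing) auto
      then show ?thesis
        using order_trans[OF small[of "k n"] ennreal_leI] by (simp add: z_def u_def)
    qed
    moreover have "0 \<le> (1 / 2 :: real) ^ n" for n
      by (rule zero_le_power) simp
    ultimately have de: "integrable ?M (\<lambda>t. (infdist (dot T (z n) t) (F t (z n t)))\<^sup>2)"
      "(LINT t|?M. (infdist (dot T (z n) t) (F t (z n t)))\<^sup>2) \<le> (1 / 2) ^ n" for n
      using defect_energy[OF T H1 H2_measurable zW] by blast+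
    show "integrable ?M (\<lambda>t. (infdist (g n t) (F t (z n t)))\<^sup>2)" for n
      unfolding g_def by (rule de)
    show "(LINT t|?M. (infdist (g n t) (F t (z n t)))\<^sup>2) \<le> (1 / 2) ^ n" for n
      unfolding g_def by (rule de)
  qed (auto intro: summable_geometric)
  moreover have "AE t in ?M. (xs has_vector_derivative f t) (at t within {0..T})"
    by (rule AE_has_vector_derivative_indefinite_integral[OF L2_integrable[OF f] xs_rep])
  moreover have "AE t in ?M. t \<in> {0..T}"
    by (rule AE_I2) simp
  ultimately have "AE t in ?M. \<exists>v\<in>F t (xs t). (xs has_vector_derivative v) (at t within {0..T})"
    using hf H2_usc
  proof eventually_elim
    case (elim t)
    have "(\<lambda>n. sqrt ((infdist (g n t) (F t (z n t)))\<^sup>2)) \<longlonglongrightarrow> sqrt 0"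
      using summable_LIMSEQ_zero[OF elim(1)] by (rule tendsto_real_sqrt)
    then have "(\<lambda>n. infdist (g n t) (F t (z n t))) \<longlonglongrightarrow> 0"
      by (simp add: infdist_nonneg)
    then have "f t \<in> F t (xs t)"
      using elim H1[OF elim(3)] lim[OF elim(3)] h
      by (intro usc_closure[where G = "F t" and xs = "\<lambda>n. z n t" and v = g and h = h and t = t]) (auto simp: usc_def)
    with elim(2) show ?case
      by blast
  qed
  moreover have "abs_continuous_on {0..T} xs"
    using xsW by (simp add: W12_def)
  ultimately have sol: "xs \<in> solutions T F x0"
    using xs0 by (simp add: solutions_def)
  show ?thesis
  proof (intro exI conjI)
    show "strict_mono (r0 \<circ> k)"
      using r0 k by (rule strict_mono_o)
    show "xs \<in> admissible T x0"
      using xsW xs0 by (simp add: admissible_def)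
    show "uniform_limit {0..T} (\<lambda>n. x ((r0 \<circ> k) n)) xs sequentially"
      using unif by (simp add: z_def[abs_def] u_def)
    show "weakly_tendsto_L2 T (\<lambda>n. dot T (x ((r0 \<circ> k) n))) (dot T xs)"
      using weak by (simp add: g_def[abs_def] z_def u_def)
  qed (rule sol)
qed

end

theorem theorem4p8:
  fixes T :: real
    and x0 :: "real ^ 'd"
    and F :: "real \<Rightarrow> real ^ 'd \<Rightarrow> (real ^ 'd) set"
  assumes T: "T > 0"
    and H1: "\<And>t x. t \<in> {0..T} \<Longrightarrow> F t x \<noteq> {} \<and> closed (F t x) \<and> convex (F t x)"
    and H2_measurable: "\<And>U. open U \<Longrightarrow>
          {(t, x). t \<in> {0..T} \<and> F t x \<inter> U \<noteq> {}} \<in> sets (lebesgue_on {0..T} \<Otimes>\<^sub>M borel)"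
    and H2_usc: "AE t in lebesgue_on {0..T}. usc (F t)"
    and H3: "\<exists>m :: real \<Rightarrow> real. L2 T m \<and> (AE t in lebesgue_on {0..T}. 0 \<le> m t) \<and>
          (AE t in lebesgue_on {0..T}. \<forall>x.
             (SUP v\<in>F t x. ereal (norm v)) \<le> ereal (m t * (1 + norm x)))"
  shows "(\<forall>x\<in>admissible T x0. residual T F x = 0 \<longleftrightarrow> x \<in> solutions T F x0) \<and>
    (\<forall>x :: nat \<Rightarrow> real \<Rightarrow> real ^ 'd.
       (\<forall>n. x n \<in> admissible T x0) \<and> (\<lambda>n. residual T F (x n)) \<longlonglongrightarrow> 0 \<longrightarrow>
       (\<exists>r xs. strict_mono (r :: nat \<Rightarrow> nat) \<and> xs \<in> admissible T x0 \<and>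
          uniform_limit {0..T} (\<lambda>n. x (r n)) xs sequentially \<and>
          weakly_tendsto_L2 T (\<lambda>n. dot T (x (r n))) (dot T xs) \<and>
          xs \<in> solutions T F x0))"
proof -
  obtain m :: "real \<Rightarrow> real" where m: "L2 T m" and
    bound: "AE t in lebesgue_on {0..T}. \<forall>x. (SUP v\<in>F t x. ereal (norm v)) \<le> ereal (m t * (1 + norm x))"
    using H3 by blast
  \<comment> \<open>The absolute value makes the growth function nonnegative at every t and can only
    weaken the bound, as 1 + |x| is positive.\<close>
  have L2: "L2 T (\<lambda>t. \<bar>m t\<bar>)"
    using m by (auto simp: L2_def)
  have growth: "AE t in lebesgue_on {0..T}. \<forall>x. \<forall>v\<in>F t x. norm v \<le> \<bar>m t\<bar> * (1 + norm x)"
    using bound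
  proof eventually_elim
    case (elim t)
    show ?case
    proof (intro allI ballI)
      fix x v
      assume "v \<in> F t x"
      then have "ereal (norm v) \<le> (SUP v\<in>F t x. ereal (norm v))"
        by (rule SUP_upper)
      also have "\<dots> \<le> ereal (m t * (1 + norm x))"
        using elim by (rule spec)
      finally have "norm v \<le> m t * (1 + norm x)"
        by simp
      also have "m t * (1 + norm x) \<le> \<bar>m t\<bar> * (1 + norm x)"
        by (intro mult_right_mono) auto
      finally show "norm v \<le> \<bar>m t\<bar> * (1 + norm x)" .
    qed
  qed
  show ?thesis
  proof (intro conjI ballI allI impI)
    show "residual T F x = 0 \<longleftrightarrow> x \<in> solutions T F x0" if "x \<in> admissible T x0" for x
      by (rule residual_eq_0_iff[OF T H1 H2_measurable that])
  next
    fix x :: "nat \<Rightarrow> real \<Rightarrow> real ^ 'd"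
    assume x: "(\<forall>n. x n \<in> admissible T x0) \<and> (\<lambda>n. residual T F (x n)) \<longlonglongrightarrow> 0"
    show "\<exists>r xs. strict_mono (r :: nat \<Rightarrow> nat) \<and> xs \<in> admissible T x0 \<and>
          uniform_limit {0..T} (\<lambda>n. x (r n)) xs sequentially \<and>
          weakly_tendsto_L2 T (\<lambda>n. dot T (x (r n))) (dot T xs) \<and>
          xs \<in> solutions T F x0"
      by (rule subsequence_converges_to_solution[OF T H1 H2_measurable H2_usc L2 abs_ge_zero growth])
         (use x in simp_all)
  qed
qed

end
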